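(* Let $P$ be a finite abelian $2$-group of type $e$ (where $e \in E(n)$, $n \geq 1$). Then $$\mathrm{Spec}_R(P) = \{2^{i} \mid i \in \{b(e) + c(e), \ldots, \Sigma(e)\}\}.$$
   Context: Reidemeister spectrum: for a group $G$ and an endomorphism $\varphi$ of $G$, elements $x,y\in G$ are $\varphi$-conjugate if there is $z \in G$ with $x = z y \varphi(z)^{-1}$. The Reidemeister number $R(\varphi)$ is the number of $\varphi$-conjugacy classes, and $\mathrm{Spec}_R(G) = \{R(\psi) \mid \psi \in \mathrm{Aut}(G)\}$. Types: for an integer $n \geq 1$, $E(n)$ is the set of $e=(e_1,\ldots,e_n)\in\mathbb{Z}^n$ with $1 \leq e_1 \leq e_2 \leq \cdots \leq e_n$. A finite abelian $2$-group is of type $e \in E(n)$ if it is isomorphic to $\bigoplus_{i=1}^n \mathbb{Z}/2^{e_i}\mathbb{Z}$. Put $\Sigma(e) = \sum_{i=1}^n e_i$. $abc$-decomposition: given $e \in E(n)$, its entries are decomposed into blocks as follows. Step 1: each maximal constant subsequence (of consecutive entries) of $e_1,\ldots,e_n$ of length at least $2$ forms one block, called an $a$-block. Step 2: among the remaining entries, starting from the left, one looks for successive entries $e_i, e_{i+1}$ (both not yet placed in a block) with $e_{i+1} = e_i + 1$; each such pair forms one block, called a $b$-block (the search is greedy from left to right and each entry belongs to at most one block). Step 3: each remaining entry forms a block by itself, called a $c$-block. The numbers of $a$-, $b$- and $c$-blocks are denoted $a(e)$, $b(e)$, $c(e)$. *)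

theory Defs
  imports
    "HOL-Algebra.Product_Groups"
    "HOL-Algebra.Bij"
    "HOL-Library.Extended_Nat"
begin

section \<open>Reidemeister numbers and the Reidemeister spectrum\<close>

definition twisted_conj :: "('a, 'b) monoid_scheme \<Rightarrow> ('a \<Rightarrow> 'a) \<Rightarrow> ('a \<times> 'a) set"
  where "twisted_conj G \<phi> =
    {(x, y). x \<in> carrier G \<and> y \<in> carrier G \<and>
       (\<exists>z\<in>carrier G. x = z \<otimes>\<^bsub>G\<^esub> y \<otimes>\<^bsub>G\<^esub> inv\<^bsub>G\<^esub> (\<phi> z))}"

definition reidemeister_number :: "('a, 'b) monoid_scheme \<Rightarrow> ('a \<Rightarrow> 'a) \<Rightarrow> enat"
  where "reidemeister_number G \<phi> =
    (if finite (carrier G // twisted_conj G \<phi>)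
     then enat (card (carrier G // twisted_conj G \<phi>)) else \<infinity>)"

definition reidemeister_spectrum :: "('a, 'b) monoid_scheme \<Rightarrow> enat set"
  where "reidemeister_spectrum G = reidemeister_number G ` auto G"

section \<open>Types of finite abelian 2-groups\<close>

text \<open>A tuple $(e_1, \ldots, e_n)$ is the list whose entry number $i - 1$ is $e_i$.\<close>

definition group_types :: "nat \<Rightarrow> nat list set"
  where "group_types n = {e. length e = n \<and> sorted e \<and> (\<forall>x\<in>set e. 1 \<le> x)}"

definition of_type :: "('a, 'b) monoid_scheme \<Rightarrow> nat list \<Rightarrow> bool"
  where "of_type P e \<longleftrightarrow>
    P \<cong> sum_group {..<length e} (\<lambda>i. integer_mod_group (2 ^ (e ! i)))"

section \<open>The abc-decomposition\<close>

text \<open>A block is represented by the set of positions of its entries.\<close>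

definition constant_runs :: "nat list \<Rightarrow> nat set set"
  where "constant_runs e =
    {{i..j} | i j. i \<le> j \<and> j < length e \<and> (\<forall>k\<in>{i..j}. e ! k = e ! i)}"

definition a_blocks :: "nat list \<Rightarrow> nat set set"
  where "a_blocks e =
    {A \<in> constant_runs e. 2 \<le> card A \<and> (\<forall>B\<in>constant_runs e. A \<subseteq> B \<longrightarrow> A = B)}"

text \<open>Greedy search for pairs from position \<open>i\<close> on, using only positions in \<open>U\<close>.\<close>

function b_search :: "nat list \<Rightarrow> nat set \<Rightarrow> nat \<Rightarrow> nat set set"
  where "b_search e U i =
    (if Suc i < length e then
       if i \<in> U \<and> Suc i \<in> U \<and> e ! Suc i = e ! i + 1
       then insert {i, Suc i} (b_search e U (i + 2))
       else b_search e U (i + 1)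
     else {})"
  by pat_completeness simp_all
termination by (relation "measure (\<lambda>(e, U, i). length e - i)") auto

declare b_search.simps [simp del]

definition b_blocks :: "nat list \<Rightarrow> nat set set"
  where "b_blocks e = b_search e ({..<length e} - \<Union> (a_blocks e)) 0"

definition c_blocks :: "nat list \<Rightarrow> nat set set"
  where "c_blocks e = {{i} | i. i < length e \<and> i \<notin> \<Union> (a_blocks e \<union> b_blocks e)}"

definition b_num :: "nat list \<Rightarrow> nat"
  where "b_num e = card (b_blocks e)"

definition c_num :: "nat list \<Rightarrow> nat"
  where "c_num e = card (c_blocks e)"

end

theory Submission
  imports Defs "HOL-Computational_Algebra.Primes"
begin

text \<open>
In an abelian group the twisted conjugacy class of \<open>y\<close> under \<open>\<phi>\<close> is the coset of \<open>y\<close> modulo the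
image of \<open>\<delta> x = x - \<phi> x\<close>. In a finite abelian group the Reidemeister number is therefore the index of the
image of \<open>\<delta>\<close>, which equals the order of its kernel, the group of fixed points of \<open>\<phi>\<close>
(\<open>reidemeister_number_eq_card_fixed_points\<close>). The theorem thus concerns the possible numbers of
fixed points of automorphisms of the direct sum of the groups \<open>\<int>/2^e\<^sub>i\<close>. By Lagrange such a number is
a power of two with exponent at most \<open>\<Sigma>(e)\<close>.

Lower bound (\<open>card_fixed_points_lower_bound\<close>). Let \<open>S\<close> consist of the first position of each b-block
and of each c-block. The exponents at these positions occur only once in \<open>e\<close>, and, because the search
for pairs is greedy, no two of them are consecutive integers. Put
\<open>f n = |{s \<in> S. e\<^sub>s \<le> n}|\<close> and \<open>g n = |{s \<in> S. e\<^sub>s < n}|\<close>, and let \<open>A\<close> and \<open>B\<close> be the subgroups of all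
vectors whose \<open>i\<close>-th coordinate is divisible by \<open>2^f(e\<^sub>i)\<close> and \<open>2^g(e\<^sub>i)\<close>, respectively. Then
\<open>A\<close> has index \<open>2^|S|\<close> in \<open>B\<close>, and \<open>\<delta>\<close> maps \<open>B\<close> into \<open>A\<close>. Indeed, a homomorphism from
\<open>\<int>/2^m\<close> to \<open>\<int>/2^n\<close> with \<open>m < n\<close> is divisible by \<open>2^(n - m)\<close>, which is at least the number of elements
of \<open>S\<close> with exponent in \<open>{m..n}\<close> as these are separated by gaps; and at a position of \<open>S\<close> the
diagonal entry of \<open>\<phi>\<close> is odd, because \<open>\<phi>\<close> is invertible and the exponent is simple, so that the diagonal
entry of \<open>\<delta>\<close> is even. Hence \<open>\<delta>\<close> has a kernel of order at least \<open>|B|/|A| = 2^|S|\<close>.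

Realisation (\<open>all_exponents_from_abc_blocks\<close>). Fixed points of a direct sum of automorphisms multiply,
so the exponents reached on disjoint blocks add up, and sums of intervals of integers are intervals. It suffices
to reach all exponents from 0 on an a-block and from 1 on a b- or c-block. On \<open>\<int>/2^k\<close> multiplication
by \<open>1 + 2^t\<close> has \<open>2^t\<close> fixed points for \<open>1 \<le> t \<le> k\<close>. Combining these leaves only three small values: two
fixed points on a pair of equal or consecutive exponents, and a single fixed point on a pair and on a
triple of equal exponents, from which all longer constant blocks are assembled.
\<close>

section \<open>Reidemeister numbers of abelian groups as numbers of fixed points\<close>

definition fixed_points :: "('a, 'b) monoid_scheme \<Rightarrow> ('a \<Rightarrow> 'a) \<Rightarrow> 'a set"
  where "fixed_points G \<phi> = {x \<in> carrier G. \<phi> x = x}"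

lemma (in comm_group) id_div_endomorphism_hom:
  assumes "\<phi> \<in> hom G G"
  shows "(\<lambda>x. x \<otimes> inv (\<phi> x)) \<in> hom G G"
proof (rule homI)
  fix x y assume xy: "x \<in> carrier G" "y \<in> carrier G"
  then have c: "\<phi> x \<in> carrier G" "\<phi> y \<in> carrier G"
    using assms by (auto simp: hom_def)
  with xy show "x \<otimes> inv (\<phi> x) \<in> carrier G" by simp
  show "x \<otimes> y \<otimes> inv (\<phi> (x \<otimes> y)) = x \<otimes> inv (\<phi> x) \<otimes> (y \<otimes> inv (\<phi> y))"
    using xy c hom_mult[OF assms xy] by (simp add: inv_mult m_ac)
qed

lemma (in comm_group) id_div_endomorphism_eq_one_iff:
  assumes "\<phi> \<in> hom G G" "x \<in> carrier G"
  shows "x \<otimes> inv (\<phi> x) = \<one> \<longleftrightarrow> \<phi> x = x"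
proof -
  have "\<phi> x \<in> carrier G"
    using assms by (auto simp: hom_def)
  then show ?thesis
    using assms(2) by (metis inv_equality inv_inv inv_closed r_inv)
qed

text \<open>The twisted conjugacy classes are the cosets of the image of \<open>\<delta> x = x - \<phi> x\<close>. By Lagrange and the first isomorphism
theorem the index of the image of \<open>\<delta>\<close> is the order of its kernel.\<close>

lemma (in comm_group) reidemeister_number_eq_card_fixed_points:
  assumes fin: "finite (carrier G)" and \<phi>: "\<phi> \<in> hom G G"
  shows "reidemeister_number G \<phi> = enat (card (fixed_points G \<phi>))"
proof -
  define \<delta> where "\<delta> = (\<lambda>x. x \<otimes> inv (\<phi> x))"
  have \<delta>: "\<delta> \<in> hom G G"
    unfolding \<delta>_def by (rule id_div_endomorphism_hom[OF \<phi>])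
  interpret \<delta>: group_hom G G \<delta>
    using \<delta> by unfold_locales
  define H where "H = \<delta> ` carrier G"
  have H: "subgroup H G"
    unfolding H_def by (rule \<delta>.img_is_subgroup)
  have coset: "twisted_conj G \<phi> `` {x} = H #> x" if x: "x \<in> carrier G" for x
  proof -
    have "(x, y) \<in> twisted_conj G \<phi> \<longleftrightarrow> (\<exists>h\<in>H. y = h \<otimes> x)" for y
    proof
      assume "(x, y) \<in> twisted_conj G \<phi>"
      then obtain z where y: "y \<in> carrier G" and z: "z \<in> carrier G"
        and eq: "x = z \<otimes> y \<otimes> inv (\<phi> z)"
        by (auto simp: twisted_conj_def)
      have "\<phi> z \<in> carrier G" using z \<phi> by (auto simp: hom_def)
      then have "x = \<delta> z \<otimes> y"
        using eq y z by (simp add: \<delta>_def m_ac)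
      then have "y = inv (\<delta> z) \<otimes> x"
        using y z by (simp add: inv_solve_left)
      moreover have "inv (\<delta> z) \<in> H"
        using H z by (auto simp: H_def intro: subgroup.m_inv_closed)
      ultimately show "\<exists>h\<in>H. y = h \<otimes> x" by blast
    next
      assume "\<exists>h\<in>H. y = h \<otimes> x"
      then obtain z where z: "z \<in> carrier G" and y: "y = \<delta> z \<otimes> x"
        by (auto simp: H_def)
      have yc: "y \<in> carrier G" using y x z by simp
      have c: "\<phi> (inv z) \<in> carrier G" using z \<phi> by (auto simp: hom_def)
      have "x = inv (\<delta> z) \<otimes> y"
        using y yc x z by (simp add: inv_solve_left)
      also have "inv (\<delta> z) = \<delta> (inv z)"
        using z by simp
      also have "\<delta> (inv z) \<otimes> y = inv z \<otimes> y \<otimes> inv (\<phi> (inv z))"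
        using z yc c by (simp add: \<delta>_def m_ac)
      finally show "(x, y) \<in> twisted_conj G \<phi>"
        using x yc z unfolding twisted_conj_def by blast
    qed
    then show ?thesis
      by (auto simp: r_coset_def)
  qed
  have quot: "carrier G // twisted_conj G \<phi> = rcosets H"
    unfolding quotient_def RCOSETS_def using coset by auto
  have ker: "kernel G G \<delta> = fixed_points G \<phi>"
    using id_div_endomorphism_eq_one_iff[OF \<phi>]
    by (auto simp: kernel_def fixed_points_def \<delta>_def)
  have sub: "subgroup (kernel G G \<delta>) G"
    by (rule \<delta>.subgroup_kernel)
  have "card (rcosets (kernel G G \<delta>)) = card H"
  proof -
    interpret \<delta>': group_hom G "G\<lparr>carrier := H\<rparr>" \<delta>
      using \<delta> subgroup.subgroup_is_group[OF H is_group] is_group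
      by (simp add: group_hom_def group_hom_axioms_def hom_def H_def Pi_iff)
    have "G Mod kernel G G \<delta> \<cong> G\<lparr>carrier := H\<rparr>"
      using \<delta>'.FactGroup_iso by (simp add: kernel_def H_def)
    then show ?thesis
      using iso_same_card by (fastforce simp: FactGroup_def)
  qed
  then have "card (rcosets H) * card H = card (fixed_points G \<phi>) * card H"
    using lagrange[OF H] lagrange[OF sub] by (simp add: ker mult.commute)
  moreover have "card H \<noteq> 0"
    using fin one_closed by (auto simp: H_def)
  ultimately have "card (rcosets H) = card (fixed_points G \<phi>)"
    by simp
  moreover have "finite (rcosets H)"
    unfolding RCOSETS_def using fin by simp
  ultimately show ?thesis
    by (simp add: reidemeister_number_def quot)
qed

text \<open>Nonempty fibres of \<open>x - \<phi> x\<close> are cosets of the group of fixed points, so a set that this map squeezes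
into a smaller set forces many fixed points. This is how fixed points are bounded from below.\<close>

lemma (in comm_group) card_le_mult_card_fixed_points:
  assumes fin: "finite (carrier G)" and \<phi>: "\<phi> \<in> hom G G"
    and B: "B \<subseteq> carrier G" and A: "finite A"
    and BA: "\<And>x. x \<in> B \<Longrightarrow> x \<otimes> inv (\<phi> x) \<in> A"
  shows "card B \<le> card A * card (fixed_points G \<phi>)"
proof -
  interpret \<phi>: group_hom G G \<phi>
    using \<phi> by unfold_locales
  have finF: "finite (fixed_points G \<phi>)"
    using fin by (simp add: fixed_points_def)
  have fibre: "card {x \<in> B. x \<otimes> inv (\<phi> x) = a} \<le> card (fixed_points G \<phi>)" for a
  proof (cases "{x \<in> B. x \<otimes> inv (\<phi> x) = a} = {}")
    case True
    then show ?thesis by (metis card.empty le0)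
  next
    case False
    then obtain y where y: "y \<in> carrier G" "y \<otimes> inv (\<phi> y) = a"
      using B by auto
    show ?thesis
    proof (rule card_inj_on_le[OF _ _ finF])
      show "inj_on (\<lambda>x. x \<otimes> inv y) {x \<in> B. x \<otimes> inv (\<phi> x) = a}"
        using B y(1) by (intro inj_onI) (auto simp: subset_iff)
      show "(\<lambda>x. x \<otimes> inv y) ` {x \<in> B. x \<otimes> inv (\<phi> x) = a} \<subseteq> fixed_points G \<phi>"
      proof clarify
        fix x assume "x \<in> B" and a: "a = x \<otimes> inv (\<phi> x)"
        then have x: "x \<in> carrier G" using B by auto
        have h: "(\<lambda>x. x \<otimes> inv (\<phi> x)) \<in> hom G G"
          by (rule id_div_endomorphism_hom[OF \<phi>])
        interpret h: group_hom G G "\<lambda>x. x \<otimes> inv (\<phi> x)"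
          using h by unfold_locales
        have "x \<otimes> inv y \<otimes> inv (\<phi> (x \<otimes> inv y)) = a \<otimes> inv a"
          using h.hom_mult[of x "inv y"] h.hom_inv[of y] x y a by simp
        also have "\<dots> = \<one>"
          using a x by simp
        finally show "x \<otimes> inv y \<in> fixed_points G \<phi>"
          using id_div_endomorphism_eq_one_iff[OF \<phi>, of "x \<otimes> inv y"] x y
          by (simp add: fixed_points_def)
      qed
    qed
  qed
  have "B = (\<Union>a\<in>A. {x \<in> B. x \<otimes> inv (\<phi> x) = a})"
    using BA by auto
  then have "card B \<le> (\<Sum>a\<in>A. card {x \<in> B. x \<otimes> inv (\<phi> x) = a})"
    using card_UN_le[OF A] by metis
  also have "\<dots> \<le> card A * card (fixed_points G \<phi>)"
    using sum_bounded_above[of A, OF fibre] by simp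
  finally show ?thesis .
qed

lemma conjugate_automorphism:
  assumes "group G" "group H" and h: "h \<in> iso G H" and \<phi>: "\<phi> \<in> iso G G"
  obtains \<psi> where "\<psi> \<in> iso H H" "card (fixed_points H \<psi>) = card (fixed_points G \<phi>)"
proof -
  define k where "k = inv_into (carrier G) h"
  have k: "k \<in> iso H G"
    unfolding k_def by (rule group.iso_set_sym[OF assms(1) h])
  have bij: "bij_betw h (carrier G) (carrier H)"
    using h by (simp add: iso_def)
  have kh: "k (h x) = x" if "x \<in> carrier G" for x
    using bij that by (simp add: k_def bij_betw_def)
  have hk: "h (k y) = y" "k y \<in> carrier G" if "y \<in> carrier H" for y
    using bij that by (auto simp: k_def bij_betw_def f_inv_into_f inv_into_into)
  define \<psi> where "\<psi> = h \<circ> (\<phi> \<circ> k)"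
  have "\<psi> \<in> iso H H"
    unfolding \<psi>_def by (rule iso_set_trans[OF iso_set_trans[OF k \<phi>] h])
  moreover have "bij_betw h (fixed_points G \<phi>) (fixed_points H \<psi>)"
  proof (rule bij_betw_byWitness[where f' = k])
    show "\<forall>x\<in>fixed_points G \<phi>. k (h x) = x"
      by (simp add: fixed_points_def kh)
    show "\<forall>y\<in>fixed_points H \<psi>. h (k y) = y"
      by (simp add: fixed_points_def hk)
    show "h ` fixed_points G \<phi> \<subseteq> fixed_points H \<psi>"
      using h by (auto simp: fixed_points_def \<psi>_def kh iso_def hom_def)
    show "k ` fixed_points H \<psi> \<subseteq> fixed_points G \<phi>"
    proof clarify
      fix y assume "y \<in> fixed_points H \<psi>"
      then have y: "y \<in> carrier H" and "h (\<phi> (k y)) = y"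
        by (auto simp: fixed_points_def \<psi>_def)
      moreover have "\<phi> (k y) \<in> carrier G"
        using \<phi> hk(2)[OF y] by (auto simp: iso_def hom_def)
      ultimately have "\<phi> (k y) = k y"
        using kh by metis
      then show "k y \<in> fixed_points G \<phi>"
        using hk(2)[OF y] by (simp add: fixed_points_def)
    qed
  qed
  ultimately show thesis
    using that bij_betw_same_card by metis
qed

text \<open>Elements of \<open>auto G\<close> are extensional functions while those of \<open>iso G G\<close> are arbitrary outside the
carrier; since fixed points lie in the carrier, both sets give the same counts.\<close>

lemma (in comm_group) reidemeister_spectrum_eq_card_fixed_points:
  assumes fin: "finite (carrier G)"
  shows "reidemeister_spectrum G = (\<lambda>\<phi>. enat (card (fixed_points G \<phi>))) ` iso G G"
proof (intro equalityI subsetI)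
  fix r assume "r \<in> reidemeister_spectrum G"
  then obtain \<phi> where "\<phi> \<in> auto G" "r = reidemeister_number G \<phi>"
    by (auto simp: reidemeister_spectrum_def)
  then show "r \<in> (\<lambda>\<phi>. enat (card (fixed_points G \<phi>))) ` iso G G"
    using reidemeister_number_eq_card_fixed_points[OF fin]
    by (auto simp: auto_def iso_def Bij_def)
next
  fix r assume "r \<in> (\<lambda>\<phi>. enat (card (fixed_points G \<phi>))) ` iso G G"
  then obtain \<phi> where \<phi>: "\<phi> \<in> iso G G" and r: "r = enat (card (fixed_points G \<phi>))"
    by auto
  have "restrict \<phi> (carrier G) \<in> auto G"
    using \<phi> by (auto simp: auto_def iso_def Bij_def hom_def bij_betw_def inj_on_def)
  moreover have "fixed_points G (restrict \<phi> (carrier G)) = fixed_points G \<phi>"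
    by (auto simp: fixed_points_def)
  ultimately show "r \<in> reidemeister_spectrum G"
    using reidemeister_number_eq_card_fixed_points[OF fin] r
    unfolding reidemeister_spectrum_def auto_def by (metis (no_types, lifting) IntD1 image_eqI)
qed

section \<open>Direct sums of cyclic 2-groups\<close>

text \<open>The index set and the exponents are kept separate, so that a subset of the positions of a type directly
yields the direct summand that belongs to it.\<close>

definition cyclic_2_product :: "'i set \<Rightarrow> ('i \<Rightarrow> nat) \<Rightarrow> ('i \<Rightarrow> int) monoid"
  where "cyclic_2_product I d = product_group I (\<lambda>i. integer_mod_group (2 ^ d i))"

lemma carrier_cyclic_2_product:
  "carrier (cyclic_2_product I d) = (\<Pi>\<^sub>E i\<in>I. {0..<2 ^ d i})"
  by (simp add: cyclic_2_product_def carrier_integer_mod_group)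

lemma mult_cyclic_2_product:
  "x \<otimes>\<^bsub>cyclic_2_product I d\<^esub> y = (\<lambda>i\<in>I. (x i + y i) mod 2 ^ d i)"
  by (simp add: cyclic_2_product_def)

lemma one_cyclic_2_product: "\<one>\<^bsub>cyclic_2_product I d\<^esub> = (\<lambda>i\<in>I. 0)"
  by (simp add: cyclic_2_product_def)

lemma comm_group_cyclic_2_product: "comm_group (cyclic_2_product I d)"
proof (rule group.group_comm_groupI)
  show "group (cyclic_2_product I d)"
    by (simp add: cyclic_2_product_def)
qed (simp add: mult_cyclic_2_product add.commute)

lemmas group_cyclic_2_product = comm_group.axioms(2)[OF comm_group_cyclic_2_product]

lemma inv_cyclic_2_product:
  "x \<in> carrier (cyclic_2_product I d) \<Longrightarrow>
    inv\<^bsub>cyclic_2_product I d\<^esub> x = (\<lambda>i\<in>I. (- x i) mod 2 ^ d i)"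
  unfolding cyclic_2_product_def by (subst inv_product_group) (auto simp: PiE_iff intro!: restrict_ext)

lemma pow_cyclic_2_product:
  assumes "x \<in> carrier (cyclic_2_product I d)"
  shows "x [^]\<^bsub>cyclic_2_product I d\<^esub> (n::nat) = (\<lambda>i\<in>I. (int n * x i) mod 2 ^ d i)"
proof (induction n)
  case 0
  then show ?case by (simp add: one_cyclic_2_product nat_pow_def cong: restrict_cong)
next
  case (Suc n)
  then show ?case
    using assms by (auto simp: mult_cyclic_2_product algebra_simps mod_simps nat_pow_def intro!: restrict_ext)
qed

lemma finite_carrier_cyclic_2_product:
  "finite I \<Longrightarrow> finite (carrier (cyclic_2_product I d))"
  by (simp add: carrier_cyclic_2_product finite_PiE)

lemma card_multiples_power_2:
  assumes "k \<le> n"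
  shows "card {x \<in> {0..<2 ^ n}. 2 ^ k dvd (x::int)} = 2 ^ (n - k)"
proof -
  have eq: "(2::int) ^ n = 2 ^ k * 2 ^ (n - k)"
    using assms by (simp flip: power_add)
  have "{x \<in> {0..<2 ^ n}. 2 ^ k dvd (x::int)} = (\<lambda>y. 2 ^ k * y) ` {0..<2 ^ (n - k)}"
    by (auto simp: eq zero_le_mult_iff)
  moreover have "inj_on (\<lambda>y::int. 2 ^ k * y) {0..<2 ^ (n - k)}"
    by (auto intro: inj_onI)
  ultimately show ?thesis
    by (simp add: card_image nat_power_eq)
qed

lemma card_divisible_coordinates:
  assumes "finite I" "\<And>i. i \<in> I \<Longrightarrow> h i \<le> d i"
  shows "card {x \<in> carrier (cyclic_2_product I d). \<forall>i\<in>I. 2 ^ h i dvd x i} = 2 ^ (\<Sum>i\<in>I. d i - h i)"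
proof -
  have "{x \<in> carrier (cyclic_2_product I d). \<forall>i\<in>I. 2 ^ h i dvd x i}
      = (\<Pi>\<^sub>E i\<in>I. {x \<in> {0..<2 ^ d i}. 2 ^ h i dvd x})"
    by (auto simp: carrier_cyclic_2_product PiE_iff extensional_def)
  then have "card {x \<in> carrier (cyclic_2_product I d). \<forall>i\<in>I. 2 ^ h i dvd x i}
      = (\<Prod>i\<in>I. card {x \<in> {0..<2 ^ d i}. 2 ^ h i dvd (x::int)})"
    using assms(1) by (simp add: card_PiE)
  also have "\<dots> = (\<Prod>i\<in>I. 2 ^ (d i - h i))"
    by (intro prod.cong refl card_multiples_power_2 assms(2))
  also have "\<dots> = 2 ^ (\<Sum>i\<in>I. d i - h i)"
    by (simp add: power_sum)
  finally show ?thesis .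
qed

lemma card_cyclic_2_product:
  assumes "finite I"
  shows "card (carrier (cyclic_2_product I d)) = 2 ^ (\<Sum>i\<in>I. d i)"
  using card_divisible_coordinates[OF assms, of "\<lambda>_. 0" d] by simp

lemma subgroup_divisible_coordinates:
  assumes "\<And>i. i \<in> I \<Longrightarrow> h i \<le> d i"
  shows "subgroup {x \<in> carrier (cyclic_2_product I d). \<forall>i\<in>I. 2 ^ h i dvd x i} (cyclic_2_product I d)"
    (is "subgroup ?H ?C")
proof -
  interpret C: comm_group ?C by (rule comm_group_cyclic_2_product)
  have dvd: "(2::int) ^ h i dvd 2 ^ d i" if "i \<in> I" for i
    using assms that by (simp add: le_imp_power_dvd)
  show ?thesis
  proof (rule C.subgroupI)
    show "?H \<subseteq> carrier ?C" by auto
    have "\<one>\<^bsub>?C\<^esub> \<in> ?H"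
      by (simp add: one_cyclic_2_product carrier_cyclic_2_product)
    then show "?H \<noteq> {}" by blast
    show "inv\<^bsub>?C\<^esub> x \<in> ?H" if "x \<in> ?H" for x
      using that C.inv_closed[of x] dvd by (simp add: inv_cyclic_2_product dvd_mod)
    show "x \<otimes>\<^bsub>?C\<^esub> y \<in> ?H" if "x \<in> ?H" "y \<in> ?H" for x y
      using that C.m_closed[of x y] dvd by (simp add: mult_cyclic_2_product dvd_mod)
  qed
qed

text \<open>A vector is the product of its coordinate vectors; adding one coordinate at a time shows that a subgroup
containing all of them contains the vector.\<close>

lemma mem_subgroup_cyclic_2_product_if_coordinates:
  assumes fin: "finite I" and K: "subgroup K (cyclic_2_product I d)"
    and x: "x \<in> carrier (cyclic_2_product I d)"
    and coord: "\<And>j. j \<in> I \<Longrightarrow> (\<lambda>i\<in>I. if i = j then x j else 0) \<in> K"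
  shows "x \<in> K"
proof -
  have "J \<subseteq> I \<Longrightarrow> (\<lambda>i\<in>I. if i \<in> J then x i else 0) \<in> K" if "finite J" for J
    using that
  proof (induction J rule: finite_induct)
    case empty
    have "(\<lambda>i\<in>I. if i \<in> {} then x i else 0) = \<one>\<^bsub>cyclic_2_product I d\<^esub>"
      by (auto simp: one_cyclic_2_product)
    then show ?case
      using subgroup.one_closed[OF K] by metis
  next
    case (insert j J)
    have "(\<lambda>i\<in>I. if i \<in> insert j J then x i else 0) =
        (\<lambda>i\<in>I. if i = j then x j else 0) \<otimes>\<^bsub>cyclic_2_product I d\<^esub> (\<lambda>i\<in>I. if i \<in> J then x i else 0)"
      using insert.hyps x
      by (auto simp: mult_cyclic_2_product carrier_cyclic_2_product PiE_iff intro!: restrict_ext)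
    also have "\<dots> \<in> K"
      using insert.prems by (intro subgroup.m_closed[OF K coord insert.IH]) auto
    finally show ?case .
  qed
  from this[OF fin] have "(\<lambda>i\<in>I. x i) \<in> K"
    by (simp cong: restrict_cong)
  moreover have "(\<lambda>i\<in>I. x i) = x"
    using x by (intro extensional_restrict) (auto simp: carrier_cyclic_2_product PiE_def)
  ultimately show ?thesis by simp
qed

section \<open>The lower bound for the number of fixed points\<close>

text \<open>If \<open>m \<in> T\<close> then \<open>m - 1\<close> is a missing element of \<open>{n..m}\<close>, otherwise \<open>m\<close> itself is one. The strict
inequality \<open>n < m\<close> ensures that \<open>m - 1\<close> belongs to the interval.\<close>

lemma card_separated_le:
  fixes T :: "nat set"
  assumes "n < m" "T \<subseteq> {n..m}" "\<And>t. t \<in> T \<Longrightarrow> Suc t \<notin> T"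
  shows "card T \<le> m - n"
proof (cases "m \<in> T")
  case True
  then have "T \<subseteq> {n..m} - {m - 1}"
    using assms(1,2) assms(3)[of "m - 1"] by auto
  then have "card T \<le> card ({n..m} - {m - 1})"
    by (intro card_mono) auto
  also have "\<dots> = m - n"
    using assms(1) by simp
  finally show ?thesis .
next
  case False
  then have "T \<subseteq> {n..<m}"
    using assms(2) by (metis atLeastAtMost_iff atLeastLessThan_iff le_neq_implies_less subset_iff)
  then show ?thesis
    using card_mono[of "{n..<m}" T] by simp
qed

text \<open>The entry is \<open>1 mod 2 ^ d j\<close> rather than 1 so that the vector lies in the group also when \<open>d j = 0\<close>.\<close>

definition basis_vector :: "'i set \<Rightarrow> ('i \<Rightarrow> nat) \<Rightarrow> 'i \<Rightarrow> 'i \<Rightarrow> int"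
  where "basis_vector I d j = (\<lambda>i\<in>I. if i = j then 1 mod 2 ^ d j else 0)"

lemma basis_vector_closed: "basis_vector I d j \<in> carrier (cyclic_2_product I d)"
  by (auto simp: basis_vector_def carrier_cyclic_2_product)

text \<open>The basis vector has order dividing \<open>2 ^ d j\<close>, hence so does its image.\<close>

lemma hom_basis_vector_divisible:
  assumes \<phi>: "\<phi> \<in> hom (cyclic_2_product I d) (cyclic_2_product I d)" and i: "i \<in> I"
  shows "2 ^ d i dvd 2 ^ d j * \<phi> (basis_vector I d j) i"
proof -
  let ?C = "cyclic_2_product I d" and ?u = "basis_vector I d j"
  interpret \<phi>: group_hom ?C ?C \<phi>
    using \<phi> group_cyclic_2_product by (simp add: group_hom_def group_hom_axioms_def)
  have u: "?u \<in> carrier ?C" by (rule basis_vector_closed)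
  have "?u [^]\<^bsub>?C\<^esub> (2 ^ d j :: nat) = \<one>\<^bsub>?C\<^esub>"
    unfolding pow_cyclic_2_product[OF u] one_cyclic_2_product
    by (auto simp: basis_vector_def mod_simps intro!: restrict_ext)
  then have "\<phi> ?u [^]\<^bsub>?C\<^esub> (2 ^ d j :: nat) = \<one>\<^bsub>?C\<^esub>"
    using \<phi>.hom_nat_pow[OF u, of "2 ^ d j"] by simp
  from fun_cong[OF this, of i] show ?thesis
    using i \<phi>.hom_closed[OF u] by (simp add: pow_cyclic_2_product one_cyclic_2_product mod_eq_0_iff_dvd)
qed

text \<open>Let \<open>x\<close> be the element of order two in the summand \<open>s\<close>, of exponent \<open>k\<close>. It is divisible by \<open>2^(k - 1)\<close>
but not by \<open>2^k\<close> in the group. In \<open>\<phi> x\<close>, an element of order two divisible by \<open>2^(k - 1)\<close>, the coordinates with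
smaller exponent vanish and those with larger exponent are divisible by \<open>2^k\<close>; only the coordinate \<open>s\<close>
is left, as no other exponent equals \<open>k\<close>. If the diagonal entry were even, this coordinate would vanish too, so \<open>\<phi> x\<close>
and hence \<open>x\<close> would be divisible by \<open>2^k\<close>.\<close>

lemma odd_diagonal_of_simple_exponent:
  assumes \<phi>: "\<phi> \<in> iso (cyclic_2_product I d) (cyclic_2_product I d)"
    and s: "s \<in> I" "1 \<le> d s" and simple: "\<And>i. i \<in> I \<Longrightarrow> d i = d s \<Longrightarrow> i = s"
  shows "odd (\<phi> (basis_vector I d s) s)"
proof
  let ?C = "cyclic_2_product I d" and ?u = "basis_vector I d s"
  assume even: "even (\<phi> ?u s)"
  have hom: "\<phi> \<in> hom ?C ?C" and bij: "bij_betw \<phi> (carrier ?C) (carrier ?C)"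
    using \<phi> by (auto simp: iso_def)
  interpret \<phi>: group_hom ?C ?C \<phi>
    using hom group_cyclic_2_product by (simp add: group_hom_def group_hom_axioms_def)
  have u: "?u \<in> carrier ?C" by (rule basis_vector_closed)
  define n where "n = d s - 1"
  have n: "d s = Suc n" using s(2) by (simp add: n_def)
  define x where "x = ?u [^]\<^bsub>?C\<^esub> (2 ^ n :: nat)"
  have xc: "x \<in> carrier ?C"
    unfolding x_def using u by simp
  have \<phi>x: "\<phi> x = (\<lambda>i\<in>I. (2 ^ n * \<phi> ?u i) mod 2 ^ d i)"
    unfolding x_def \<phi>.hom_nat_pow[OF u] using pow_cyclic_2_product[OF \<phi>.hom_closed[OF u], of "2 ^ n"]
    by simp
  have dvd: "2 ^ d s dvd \<phi> x i \<or> \<phi> x i = 0" if i: "i \<in> I" for i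
  proof -
    consider "d i < d s" | "i = s" | "d i > d s"
      using simple[OF i] by linarith
    then show ?thesis
    proof cases
      case 1
      then have "d i \<le> n" using n by simp
      then have "(2::int) ^ d i dvd 2 ^ n * \<phi> ?u i"
        by (simp add: le_imp_power_dvd)
      then show ?thesis using i by (simp add: \<phi>x)
    next
      case 2
      then show ?thesis using i even n by (auto simp: \<phi>x elim!: evenE)
    next
      case 3
      have "2 ^ d i dvd 2 ^ d s * \<phi> ?u i"
        by (rule hom_basis_vector_divisible[OF hom i])
      moreover have "(2::int) ^ d i = 2 ^ d s * 2 ^ (d i - d s)"
        using 3 by (simp flip: power_add)
      ultimately have "2 ^ (d i - d s) dvd \<phi> ?u i"
        by simp
      then have "2 ^ n * 2 ^ (d i - d s) dvd 2 ^ n * \<phi> ?u i"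
        by simp
      moreover have "(2::int) ^ d s dvd 2 ^ n * 2 ^ (d i - d s)"
        unfolding power_add[symmetric] using 3 n by (intro le_imp_power_dvd) simp
      ultimately have "2 ^ d s dvd 2 ^ n * \<phi> ?u i"
        by (rule dvd_trans[rotated])
      then show ?thesis
        using i 3 by (simp add: \<phi>x dvd_mod le_imp_power_dvd)
    qed
  qed
  have dvd': "2 ^ d s dvd \<phi> x i" if "i \<in> I" for i
    using dvd[OF that] by auto
  \<comment> \<open>Dividing \<open>\<phi> x\<close> by \<open>2 ^ d s\<close> inside the group and pulling the quotient back along \<open>\<phi>\<close> divides \<open>x\<close> as well.\<close>
  define y where "y = (\<lambda>i\<in>I. \<phi> x i div 2 ^ d s)"
  have y: "y \<in> carrier ?C"
  proof -
    have "0 \<le> \<phi> x i div 2 ^ d s \<and> \<phi> x i div 2 ^ d s < 2 ^ d i" if "i \<in> I" for i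
    proof -
      have "0 \<le> \<phi> x i" "\<phi> x i < 2 ^ d i"
        using \<phi>.hom_closed[OF xc] that by (auto simp: carrier_cyclic_2_product PiE_iff)
      moreover from this have "\<phi> x i div 2 ^ d s \<le> \<phi> x i"
        using zdiv_mono2[of "\<phi> x i" 1 "2 ^ d s"] by simp
      ultimately show ?thesis
        by (simp add: pos_imp_zdiv_nonneg_iff)
    qed
    then show ?thesis by (auto simp: y_def carrier_cyclic_2_product)
  qed
  have "\<phi> x = y [^]\<^bsub>?C\<^esub> (2 ^ d s :: nat)"
    unfolding pow_cyclic_2_product[OF y]
    using \<phi>.hom_closed[OF xc] dvd'
    by (auto simp: y_def carrier_cyclic_2_product PiE_iff fun_eq_iff extensional_def)
  moreover obtain z where z: "z \<in> carrier ?C" "\<phi> z = y"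
    using bij y by (metis bij_betw_imp_surj_on imageE)
  ultimately have "\<phi> x = \<phi> (z [^]\<^bsub>?C\<^esub> (2 ^ d s :: nat))"
    using \<phi>.hom_nat_pow by simp
  then have "x = z [^]\<^bsub>?C\<^esub> (2 ^ d s :: nat)"
    using bij xc z by (meson \<phi>.nat_pow_closed bij_betw_def inj_onD)
  then have "x s = 0"
    using s z by (simp add: pow_cyclic_2_product)
  moreover have "x s = 2 ^ n"
  proof -
    have "x s = 2 ^ n mod 2 ^ d s"
      unfolding x_def pow_cyclic_2_product[OF u] using s(1) by (simp add: basis_vector_def mod_simps)
    then show ?thesis using n by simp
  qed
  ultimately show False by simp
qed

text \<open>With the functions \<open>f\<close> and \<open>g\<close>, which count the elements of \<open>S\<close> of exponent at most
and less than a given number, and the subgroups \<open>A\<close> and \<open>B\<close> of vectors divisible by the corresponding powers of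
two: since \<open>f\<close> exceeds \<open>g\<close> by one at the exponents of \<open>S\<close> and agrees with it elsewhere, the subgroup \<open>A\<close> has index
\<open>2 ^ card S\<close> in \<open>B\<close>. That \<open>\<delta>\<close> maps \<open>B\<close> into \<open>A\<close> is checked on multiples of basis vectors: for the matrix
entry of \<open>\<delta>\<close> from \<open>j\<close> to \<open>i\<close> to be divisible by \<open>2 ^ (f (d i) - g (d j))\<close>, the four cases are \<open>d i < d j\<close>, where
nothing is required; equal exponents outside \<open>S\<close>, where \<open>f = g\<close>; the diagonal at \<open>S\<close>, where an even entry is
required; and \<open>d j < d i\<close>, where the entry is divisible by \<open>2 ^ (d i - d j)\<close>.\<close>

lemma card_fixed_points_lower_bound:
  assumes fin: "finite I" and SI: "S \<subseteq> I" and pos: "\<And>s. s \<in> S \<Longrightarrow> 1 \<le> d s"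
    and simple: "\<And>s i. s \<in> S \<Longrightarrow> i \<in> I \<Longrightarrow> d i = d s \<Longrightarrow> i = s"
    and separated: "\<And>s t. s \<in> S \<Longrightarrow> t \<in> S \<Longrightarrow> d t \<noteq> Suc (d s)"
    and \<phi>: "\<phi> \<in> iso (cyclic_2_product I d) (cyclic_2_product I d)"
  shows "2 ^ card S \<le> card (fixed_points (cyclic_2_product I d) \<phi>)"
proof -
  let ?C = "cyclic_2_product I d" and ?u = "basis_vector I d"
  interpret C: comm_group ?C by (rule comm_group_cyclic_2_product)
  have hom: "\<phi> \<in> hom ?C ?C" using \<phi> by (simp add: iso_def)
  have finS: "finite S" using fin SI finite_subset by blast
  have inj: "inj_on d S"
    using simple SI by (auto intro!: inj_onI)
  define f where "f n = card {s \<in> S. d s \<le> n}" for n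
  define g where "g n = card {s \<in> S. d s < n}" for n
  \<comment> \<open>This guarantees that divisibility by \<open>2 ^ f (d i)\<close> is meaningful modulo \<open>2 ^ d i\<close>.\<close>
  have f_le: "f n \<le> n" for n
  proof -
    have "f n = card (d ` {s \<in> S. d s \<le> n})"
      unfolding f_def using inj by (intro card_image[symmetric]) (auto intro: inj_on_subset)
    also have "\<dots> \<le> card {1..n}"
      using pos by (intro card_mono) auto
    finally show ?thesis by simp
  qed
  have f_le_g: "f m \<le> g n" if "m < n" for m n
    unfolding f_def g_def using finS that by (intro card_mono) auto
  have f_eq_g: "f n = g n" if "\<And>s. s \<in> S \<Longrightarrow> d s \<noteq> n" for n
    unfolding f_def g_def using that by (intro arg_cong[where f = card]) (auto simp: le_less)
  have f_eq_Suc_g: "f (d s) = Suc (g (d s))" if "s \<in> S" for s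
  proof -
    have "{t \<in> S. d t \<le> d s} = insert s {t \<in> S. d t < d s}"
      using that simple SI by (auto simp: le_less)
    then show ?thesis
      unfolding f_def g_def using finS by simp
  qed
  have f_le_g_add: "f m \<le> g n + (m - n)" if "n < m" for m n
  proof -
    have "{s \<in> S. d s \<le> m} = {s \<in> S. d s < n} \<union> {s \<in> S. n \<le> d s \<and> d s \<le> m}"
      using that by auto
    then have "f m \<le> g n + card {s \<in> S. n \<le> d s \<and> d s \<le> m}"
      unfolding f_def g_def by (simp add: card_Un_le)
    also have "card {s \<in> S. n \<le> d s \<and> d s \<le> m} = card (d ` {s \<in> S. n \<le> d s \<and> d s \<le> m})"
      using inj by (intro card_image[symmetric]) (auto intro: inj_on_subset)
    also have "\<dots> \<le> m - n"
      using that by (intro card_separated_le) (auto, metis separated)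
    finally show ?thesis by simp
  qed
  have g_le_f: "g n \<le> f n" for n
    unfolding f_def g_def using finS by (intro card_mono) auto
  have g_le: "g n \<le> n" for n
    using g_le_f f_le le_trans by blast
  define A where "A = {x \<in> carrier ?C. \<forall>i\<in>I. 2 ^ f (d i) dvd x i}"
  define B where "B = {x \<in> carrier ?C. \<forall>i\<in>I. 2 ^ g (d i) dvd x i}"
  define \<delta> where "\<delta> = (\<lambda>x. x \<otimes>\<^bsub>?C\<^esub> inv\<^bsub>?C\<^esub> \<phi> x)"
  have \<delta>: "\<delta> \<in> hom ?C ?C"
    unfolding \<delta>_def by (rule C.id_div_endomorphism_hom[OF hom])
  interpret \<delta>: group_hom ?C ?C \<delta>
    using \<delta> by unfold_locales
  have A: "subgroup A ?C"
    unfolding A_def by (intro subgroup_divisible_coordinates f_le)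
  \<comment> \<open>It is easier to show that the preimage of \<open>A\<close> contains generators of \<open>B\<close> than to compute \<open>\<delta>\<close> on \<open>B\<close>.\<close>
  define K where "K = {x \<in> carrier ?C. \<delta> x \<in> A}"
  have K: "subgroup K ?C"
    unfolding K_def
  proof (rule C.subgroupI)
    show "{x \<in> carrier ?C. \<delta> x \<in> A} \<subseteq> carrier ?C" by auto
    have "\<one>\<^bsub>?C\<^esub> \<in> {x \<in> carrier ?C. \<delta> x \<in> A}"
      using subgroup.one_closed[OF A] by simp
    then show "{x \<in> carrier ?C. \<delta> x \<in> A} \<noteq> {}" by blast
  qed (use A in \<open>auto simp: subgroup.m_inv_closed subgroup.m_closed\<close>)
  have K_pow: "x [^]\<^bsub>?C\<^esub> (n::nat) \<in> K" if "x \<in> K" for x n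
    by (induction n) (use that K in \<open>auto simp: subgroup.one_closed subgroup.m_closed\<close>)
  have uK: "?u j [^]\<^bsub>?C\<^esub> (2 ^ g (d j) :: nat) \<in> K" if j: "j \<in> I" for j
  proof -
    have u: "?u j \<in> carrier ?C" by (rule basis_vector_closed)
    have "2 ^ f (d i) dvd 2 ^ g (d j) * \<delta> (?u j) i" if i: "i \<in> I" for i
    proof -
      consider "d i < d j" | "d i = d j" "\<And>s. s \<in> S \<Longrightarrow> d s \<noteq> d j" | "i = j" "j \<in> S" | "d j < d i"
        using simple i j by (metis linorder_neqE_nat)
      then show ?thesis
      proof cases
        case 1
        then show ?thesis
          using f_le_g by (simp add: le_imp_power_dvd)
      next
        case 2
        then show ?thesis
          using f_eq_g[of "d j"] by simp
      next
        case 3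
        have "odd (\<phi> (?u j) j)"
          using 3 pos simple by (intro odd_diagonal_of_simple_exponent[OF \<phi> j]) auto
        moreover have "odd (?u j j)"
          using 3 pos[of j] j by (simp add: basis_vector_def)
        moreover have "even ((2::int) ^ d j)"
          using 3 pos[of j] by simp
        ultimately have "even (\<delta> (?u j) j)"
          using j hom u unfolding \<delta>_def
          by (simp add: mult_cyclic_2_product inv_cyclic_2_product hom_in_carrier[of \<phi>] dvd_mod_iff)
        then show ?thesis
          using 3 f_eq_Suc_g by simp
      next
        case 4
        have "2 ^ d i dvd 2 ^ d j * \<delta> (?u j) i"
          by (rule hom_basis_vector_divisible[OF \<delta> i])
        moreover have "(2::int) ^ d i = 2 ^ d j * 2 ^ (d i - d j)"
          using 4 by (simp flip: power_add)
        ultimately have "2 ^ (d i - d j) dvd \<delta> (?u j) i"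
          by simp
        then have "2 ^ (g (d j) + (d i - d j)) dvd 2 ^ g (d j) * \<delta> (?u j) i"
          by (simp add: power_add)
        then show ?thesis
          using f_le_g_add[OF 4] power_le_dvd by blast
      qed
    qed
    then have "\<delta> (?u j) [^]\<^bsub>?C\<^esub> (2 ^ g (d j) :: nat) \<in> A"
      using C.nat_pow_closed[OF \<delta>.hom_closed[OF u], of "2 ^ g (d j)"] f_le
      by (simp add: A_def pow_cyclic_2_product \<delta>.hom_closed[OF u] dvd_mod le_imp_power_dvd)
    then show ?thesis
      using u by (simp add: K_def \<delta>.hom_nat_pow)
  qed
  have "B \<subseteq> K"
  proof
    fix x assume "x \<in> B"
    then have x: "x \<in> carrier ?C" and dvd: "\<And>i. i \<in> I \<Longrightarrow> 2 ^ g (d i) dvd x i"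
      by (auto simp: B_def)
    show "x \<in> K"
    proof (rule mem_subgroup_cyclic_2_product_if_coordinates[OF fin K x])
      fix j assume j: "j \<in> I"
      have xj: "0 \<le> x j" "x j < 2 ^ d j"
        using x j by (auto simp: carrier_cyclic_2_product PiE_iff)
      define c where "c = nat (x j div 2 ^ g (d j))"
      have c: "int c * 2 ^ g (d j) = x j"
        using dvd[OF j] xj by (simp add: c_def pos_imp_zdiv_nonneg_iff)
      have u: "?u j \<in> carrier ?C" by (rule basis_vector_closed)
      have "(?u j [^]\<^bsub>?C\<^esub> (2 ^ g (d j) :: nat)) [^]\<^bsub>?C\<^esub> c = (\<lambda>i\<in>I. if i = j then x j else 0)"
      proof -
        have "int (2 ^ g (d j) * c) = x j"
          using c by (simp add: mult.commute)
        then show ?thesis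
          unfolding C.nat_pow_pow[OF u] unfolding pow_cyclic_2_product[OF u]
          using xj by (auto simp: basis_vector_def mod_simps intro!: restrict_ext)
      qed
      moreover have "(?u j [^]\<^bsub>?C\<^esub> (2 ^ g (d j) :: nat)) [^]\<^bsub>?C\<^esub> c \<in> K"
        by (intro K_pow uK j)
      ultimately show "(\<lambda>i\<in>I. if i = j then x j else 0) \<in> K" by metis
    qed
  qed
  have finC: "finite (carrier ?C)"
    using fin by (rule finite_carrier_cyclic_2_product)
  have "card B \<le> card A * card (fixed_points ?C \<phi>)"
  proof (rule C.card_le_mult_card_fixed_points[OF finC hom])
    show "B \<subseteq> carrier ?C" by (auto simp: B_def)
    show "finite A" using finC by (simp add: A_def)
    show "x \<otimes>\<^bsub>?C\<^esub> inv\<^bsub>?C\<^esub> \<phi> x \<in> A" if "x \<in> B" for x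
      using \<open>B \<subseteq> K\<close> that unfolding K_def \<delta>_def by blast
  qed
  moreover have "card B = card A * 2 ^ card S"
  proof -
    have "d i - g (d i) = d i - f (d i) + (if i \<in> S then 1 else 0)" if i: "i \<in> I" for i
    proof (cases "i \<in> S")
      case True
      then show ?thesis using f_eq_Suc_g[OF True] f_le[of "d i"] by simp
    next
      case False
      then have "\<And>s. s \<in> S \<Longrightarrow> d s \<noteq> d i"
        using simple[OF _ i] by metis
      then show ?thesis using f_eq_g False by simp
    qed
    then have "(\<Sum>i\<in>I. d i - g (d i)) = (\<Sum>i\<in>I. d i - f (d i)) + (\<Sum>i\<in>I. if i \<in> S then 1 else 0)"
      by (simp add: sum.distrib)
    also have "(\<Sum>i\<in>I. if i \<in> S then 1 else 0) = card S"
      using fin SI by (simp add: sum.If_cases Int_absorb1)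
    finally show ?thesis
      unfolding A_def B_def using fin f_le g_le by (simp add: card_divisible_coordinates power_add)
  qed
  moreover have "card A > 0"
    using finC subgroup.one_closed[OF A] by (auto simp: card_gt_0_iff A_def)
  ultimately show ?thesis by simp
qed

section \<open>Automorphisms with a prescribed number of fixed points\<close>

definition has_fixed_exponent :: "('a, 'b) monoid_scheme \<Rightarrow> nat \<Rightarrow> bool"
  where "has_fixed_exponent G t \<longleftrightarrow> (\<exists>\<phi>\<in>iso G G. card (fixed_points G \<phi>) = 2 ^ t)"

lemma has_fixed_exponent_iso:
  assumes "group G" "group H" "G \<cong> H" "has_fixed_exponent G t"
  shows "has_fixed_exponent H t"
  using assms conjugate_automorphism[OF assms(1,2)]
  unfolding has_fixed_exponent_def is_iso_def by (metis ex_in_conv)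

lemma has_fixed_exponent_DirProd:
  assumes "has_fixed_exponent G s" "has_fixed_exponent H t" "group G" "group H"
  shows "has_fixed_exponent (G \<times>\<times> H) (s + t)"
proof -
  obtain \<phi> \<psi> where "\<phi> \<in> iso G G" "card (fixed_points G \<phi>) = 2 ^ s"
    and "\<psi> \<in> iso H H" "card (fixed_points H \<psi>) = 2 ^ t"
    using assms by (auto simp: has_fixed_exponent_def)
  moreover have "fixed_points (G \<times>\<times> H) (\<lambda>(x, y). (\<phi> x, \<psi> y)) = fixed_points G \<phi> \<times> fixed_points H \<psi>"
    by (auto simp: fixed_points_def)
  ultimately show ?thesis
    unfolding has_fixed_exponent_def using assms(3,4)
    by (intro bexI[of _ "\<lambda>(x, y). (\<phi> x, \<psi> y)"]) (auto simp: iso_paired2 card_cartesian_product power_add)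
qed

lemma (in group) endomorphism_trivial_kernel_iso:
  assumes fin: "finite (carrier G)" and \<phi>: "\<phi> \<in> hom G G"
    and ker: "\<And>x. x \<in> carrier G \<Longrightarrow> \<phi> x = \<one> \<Longrightarrow> x = \<one>"
  shows "\<phi> \<in> iso G G"
proof -
  interpret \<phi>: group_hom G G \<phi>
    using \<phi> by unfold_locales
  have inj: "inj_on \<phi> (carrier G)"
    using ker by (simp add: \<phi>.inj_on_one_iff)
  moreover have "\<phi> ` carrier G = carrier G"
    by (rule endo_inj_surj[OF fin _ inj]) auto
  ultimately show ?thesis
    using \<phi> by (simp add: iso_def bij_betw_def)
qed

definition matrix_map :: "'i set \<Rightarrow> ('i \<Rightarrow> nat) \<Rightarrow> ('i \<Rightarrow> 'i \<Rightarrow> int) \<Rightarrow> ('i \<Rightarrow> int) \<Rightarrow> 'i \<Rightarrow> int"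
  where "matrix_map I d a x = (\<lambda>i\<in>I. (\<Sum>j\<in>I. a i j * x j) mod 2 ^ d i)"

text \<open>The entry \<open>a i j\<close> induces a map from \<open>\<int>/2 ^ d j\<close> to \<open>\<int>/2 ^ d i\<close> precisely under the divisibility condition.\<close>

lemma matrix_map_hom:
  assumes compat: "\<And>i j. i \<in> I \<Longrightarrow> j \<in> I \<Longrightarrow> 2 ^ d i dvd a i j * 2 ^ d j"
  shows "matrix_map I d a \<in> hom (cyclic_2_product I d) (cyclic_2_product I d)"
proof (rule homI)
  fix x y assume "x \<in> carrier (cyclic_2_product I d)" "y \<in> carrier (cyclic_2_product I d)"
  show "matrix_map I d a x \<in> carrier (cyclic_2_product I d)"
    by (auto simp: matrix_map_def carrier_cyclic_2_product)
  have "(\<Sum>j\<in>I. a i j * ((x j + y j) mod 2 ^ d j)) mod 2 ^ d i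
      = (\<Sum>j\<in>I. a i j * (x j + y j)) mod 2 ^ d i" if i: "i \<in> I" for i
  proof -
    have "2 ^ d i dvd a i j * (z mod 2 ^ d j) - a i j * z" if "j \<in> I" for j z
    proof -
      have "a i j * (z mod 2 ^ d j) - a i j * z = - (z div 2 ^ d j) * (a i j * 2 ^ d j)"
        by (simp add: minus_div_mult_eq_mod [symmetric] algebra_simps)
      then show ?thesis
        using compat[OF i that] by simp
    qed
    then show ?thesis
      by (simp add: mod_eq_dvd_iff dvd_sum flip: sum_subtractf)
  qed
  then show "matrix_map I d a (x \<otimes>\<^bsub>cyclic_2_product I d\<^esub> y)
      = matrix_map I d a x \<otimes>\<^bsub>cyclic_2_product I d\<^esub> matrix_map I d a y"
    by (auto simp: matrix_map_def mult_cyclic_2_product mod_simps sum.distrib distrib_left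
        intro!: restrict_ext cong: sum.cong)
qed

text \<open>All explicit automorphisms below have as fixed points a set of vectors described by divisibility of the single
coordinates, which makes their number computable; on a finite group a trivial kernel suffices for bijectivity.\<close>

lemma has_fixed_exponent_matrix_map:
  fixes a :: "'i \<Rightarrow> 'i \<Rightarrow> int"
  assumes fin: "finite I"
    and compat: "\<And>i j. i \<in> I \<Longrightarrow> j \<in> I \<Longrightarrow> 2 ^ d i dvd a i j * 2 ^ d j"
    and ker: "\<And>x. \<forall>i\<in>I. 2 ^ d i dvd (\<Sum>j\<in>I. a i j * x j) \<Longrightarrow> \<forall>i\<in>I. 2 ^ d i dvd x i"
    and h: "\<And>i. i \<in> I \<Longrightarrow> h i \<le> d i"
    and fix_iff: "\<And>x. (\<forall>i\<in>I. 2 ^ d i dvd (\<Sum>j\<in>I. a i j * x j) - x i) \<longleftrightarrow> (\<forall>i\<in>I. 2 ^ h i dvd x i)"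
  shows "has_fixed_exponent (cyclic_2_product I d) (\<Sum>i\<in>I. d i - h i)"
proof -
  let ?C = "cyclic_2_product I d"
  interpret C: comm_group ?C by (rule comm_group_cyclic_2_product)
  have "matrix_map I d a \<in> iso ?C ?C"
  proof (rule C.endomorphism_trivial_kernel_iso)
    show "finite (carrier ?C)" by (rule finite_carrier_cyclic_2_product[OF fin])
    show "matrix_map I d a \<in> hom ?C ?C" by (rule matrix_map_hom[OF compat])
    fix x assume x: "x \<in> carrier ?C" and "matrix_map I d a x = \<one>\<^bsub>?C\<^esub>"
    then have "(\<Sum>j\<in>I. a i j * x j) mod 2 ^ d i = 0" if "i \<in> I" for i
      using that by (auto simp: one_cyclic_2_product matrix_map_def dest: fun_cong[where x = i])
    then have dvd: "\<forall>i\<in>I. 2 ^ d i dvd x i"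
      using ker[of x] by (simp add: mod_eq_0_iff_dvd)
    have "x i = 0" if "i \<in> I" for i
    proof -
      have "0 \<le> x i" "x i < 2 ^ d i"
        using x that by (auto simp: carrier_cyclic_2_product PiE_iff)
      then show ?thesis
        using dvd that by (metis mod_pos_pos_trivial dvd_imp_mod_0)
    qed
    then show "x = \<one>\<^bsub>?C\<^esub>"
      using x by (auto simp: one_cyclic_2_product carrier_cyclic_2_product PiE_iff extensional_def)
  qed
  moreover have "fixed_points ?C (matrix_map I d a) = {x \<in> carrier ?C. \<forall>i\<in>I. 2 ^ h i dvd x i}"
  proof -
    have "matrix_map I d a x = x \<longleftrightarrow> (\<forall>i\<in>I. 2 ^ h i dvd x i)" if x: "x \<in> carrier ?C" for x
    proof -
      have "x i mod 2 ^ d i = x i" if "i \<in> I" for i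
        using x that by (auto simp: carrier_cyclic_2_product PiE_iff)
      moreover have "x \<in> extensional I"
        using x by (auto simp: carrier_cyclic_2_product PiE_def)
      ultimately have "matrix_map I d a x = x \<longleftrightarrow> (\<forall>i\<in>I. (\<Sum>j\<in>I. a i j * x j) mod 2 ^ d i = x i mod 2 ^ d i)"
        by (auto simp: matrix_map_def fun_eq_iff extensional_def)
      then show ?thesis
        by (simp add: mod_eq_dvd_iff fix_iff)
    qed
    then show ?thesis
      by (auto simp: fixed_points_def)
  qed
  ultimately show ?thesis
    unfolding has_fixed_exponent_def using card_divisible_coordinates[of I h d] fin h
    by (intro bexI[of _ "matrix_map I d a"]) simp_all
qed

lemma cyclic_2_product_Un_iso:
  assumes "I \<inter> J = {}"
  shows "cyclic_2_product (I \<union> J) d \<cong> cyclic_2_product I d \<times>\<times> cyclic_2_product J d"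
proof (rule is_isoI)
  let ?f = "\<lambda>x::'a \<Rightarrow> int. (restrict x I, restrict x J)"
  have "?f \<in> hom (cyclic_2_product (I \<union> J) d) (cyclic_2_product I d \<times>\<times> cyclic_2_product J d)"
    by (rule homI) (auto simp: carrier_cyclic_2_product mult_cyclic_2_product PiE_iff intro!: restrict_ext)
  moreover have "bij_betw ?f (carrier (cyclic_2_product (I \<union> J) d))
      (carrier (cyclic_2_product I d \<times>\<times> cyclic_2_product J d))"
  proof (rule bij_betw_byWitness[where f' = "\<lambda>(y, z). \<lambda>i\<in>I \<union> J. if i \<in> I then y i else z i"])
    show "\<forall>x\<in>carrier (cyclic_2_product (I \<union> J) d).
        (case ?f x of (y, z) \<Rightarrow> \<lambda>i\<in>I \<union> J. if i \<in> I then y i else z i) = x"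
      by (auto simp: carrier_cyclic_2_product PiE_iff extensional_def fun_eq_iff)
    show "\<forall>p\<in>carrier (cyclic_2_product I d \<times>\<times> cyclic_2_product J d).
        ?f (case p of (y, z) \<Rightarrow> \<lambda>i\<in>I \<union> J. if i \<in> I then y i else z i) = p"
      using assms by (auto simp: carrier_cyclic_2_product PiE_iff extensional_def fun_eq_iff)
    show "?f ` carrier (cyclic_2_product (I \<union> J) d) \<subseteq> carrier (cyclic_2_product I d \<times>\<times> cyclic_2_product J d)"
      by (auto simp: carrier_cyclic_2_product PiE_iff)
    show "(\<lambda>(y, z). \<lambda>i\<in>I \<union> J. if i \<in> I then y i else z i) ` carrier (cyclic_2_product I d \<times>\<times> cyclic_2_product J d)
        \<subseteq> carrier (cyclic_2_product (I \<union> J) d)"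
      by (auto simp: carrier_cyclic_2_product PiE_iff)
  qed
  ultimately show "?f \<in> iso (cyclic_2_product (I \<union> J) d) (cyclic_2_product I d \<times>\<times> cyclic_2_product J d)"
    by (simp add: iso_def)
qed

lemma has_fixed_exponent_Un:
  assumes "I \<inter> J = {}"
    and "has_fixed_exponent (cyclic_2_product I d) s" "has_fixed_exponent (cyclic_2_product J d) t"
  shows "has_fixed_exponent (cyclic_2_product (I \<union> J) d) (s + t)"
  by (rule has_fixed_exponent_iso[OF _ _ group.iso_sym[OF _ cyclic_2_product_Un_iso[OF assms(1)]]])
    (intro group_cyclic_2_product DirProd_group has_fixed_exponent_DirProd assms(2,3))+

text \<open>The bound \<open>l \<le> sum d I\<close> makes the interval of exponents nonempty, as is needed for intervals to add up
under disjoint unions.\<close>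

definition all_exponents_from :: "('i \<Rightarrow> nat) \<Rightarrow> 'i set \<Rightarrow> nat \<Rightarrow> bool"
  where "all_exponents_from d I l \<longleftrightarrow>
    l \<le> sum d I \<and> (\<forall>t\<in>{l..sum d I}. has_fixed_exponent (cyclic_2_product I d) t)"

lemma all_exponents_from_Un:
  assumes "finite I" "finite J" "I \<inter> J = {}" "all_exponents_from d I l" "all_exponents_from d J m"
  shows "all_exponents_from d (I \<union> J) (l + m)"
proof -
  have sum: "sum d (I \<union> J) = sum d I + sum d J"
    using assms(1-3) by (rule sum.union_disjoint)
  have "has_fixed_exponent (cyclic_2_product (I \<union> J) d) t"
    if t: "l + m \<le> t" "t \<le> sum d I + sum d J" for t
  proof -
    define s where "s = min (t - m) (sum d I)"
    have "l \<le> s" "s \<le> sum d I" "m \<le> t - s" "t - s \<le> sum d J" "t = s + (t - s)"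
      using t assms(4,5) by (auto simp: s_def all_exponents_from_def)
    then show ?thesis
      using has_fixed_exponent_Un[OF assms(3), of d s "t - s"] assms(4,5)
      by (simp add: all_exponents_from_def)
  qed
  then show ?thesis
    using assms(4,5) by (auto simp: all_exponents_from_def sum)
qed

lemma all_exponents_from_pred:
  assumes "all_exponents_from d I (Suc l)" "has_fixed_exponent (cyclic_2_product I d) l"
  shows "all_exponents_from d I l"
  using assms by (auto simp: all_exponents_from_def Suc_le_eq le_less)

lemma all_exponents_from_Union:
  assumes "finite \<B>" "\<And>B. B \<in> \<B> \<Longrightarrow> finite B" "pairwise disjnt \<B>"
    and "\<And>B. B \<in> \<B> \<Longrightarrow> all_exponents_from d B (l B)"
  shows "all_exponents_from d (\<Union>\<B>) (\<Sum>B\<in>\<B>. l B)"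
  using assms
proof (induction \<B> rule: finite_induct)
  case empty
  have "has_fixed_exponent (cyclic_2_product {} d) 0"
    using has_fixed_exponent_matrix_map[of "{}" d "\<lambda>_ _. 0" d] by simp
  then show ?case by (simp add: all_exponents_from_def)
next
  case (insert B \<B>)
  have "B \<inter> \<Union>\<B> = {}"
    using insert.hyps insert.prems(2) by (auto simp: pairwise_insert disjnt_def)
  then show ?case
    using insert by (simp add: all_exponents_from_Un pairwise_insert)
qed

text \<open>Multiplication by \<open>1 + 2 ^ t\<close> fixes exactly the multiples of \<open>2 ^ (d i - t)\<close>. It is invertible because
\<open>t \<ge> 1\<close>.\<close>

lemma all_exponents_from_singleton:
  assumes "1 \<le> d i"
  shows "all_exponents_from d {i} 1"
proof -
  have "has_fixed_exponent (cyclic_2_product {i} d) t" if t: "1 \<le> t" "t \<le> d i" for t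
  proof -
    have "has_fixed_exponent (cyclic_2_product {i} d) (\<Sum>j\<in>{i}. d j - (d j - t))"
    proof (rule has_fixed_exponent_matrix_map[where a = "\<lambda>_ _. 1 + 2 ^ t"])
      fix x :: "'a \<Rightarrow> int"
      have "coprime (2 ^ d i) (1 + 2 ^ t :: int)"
        using t by simp
      then show "\<forall>j\<in>{i}. 2 ^ d j dvd x j" if "\<forall>j\<in>{i}. 2 ^ d j dvd (\<Sum>j\<in>{i}. (1 + 2 ^ t) * x j)"
        using that by (simp add: coprime_dvd_mult_right_iff)
      have "(2::int) ^ d i = 2 ^ t * 2 ^ (d i - t)"
        using t by (simp flip: power_add)
      then show "(\<forall>j\<in>{i}. 2 ^ d j dvd (\<Sum>j\<in>{i}. (1 + 2 ^ t) * x j) - x j) \<longleftrightarrow> (\<forall>j\<in>{i}. 2 ^ (d j - t) dvd x j)"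
        by (simp add: algebra_simps)
    qed auto
    then show ?thesis using t by simp
  qed
  then show ?thesis
    using assms by (simp add: all_exponents_from_def)
qed

text \<open>The two singletons give every exponent from 2 on. The exponent 1 comes from the automorphism
\<open>(x, y) \<mapsto> (x - y, y - 2x)\<close> of determinant \<open>-1\<close>: a fixed point satisfies \<open>y = 0\<close> modulo \<open>2 ^ d i\<close> and
\<open>2x = 0\<close> modulo \<open>2 ^ d j\<close>. If the exponents are equal this leaves two values of \<open>x\<close> and one of \<open>y\<close>; if they are
consecutive, one value of \<open>x\<close> and two of \<open>y\<close>.\<close>

lemma all_exponents_from_pair:
  assumes "i \<noteq> j" "1 \<le> d i" "d j = d i \<or> d j = Suc (d i)"
  shows "all_exponents_from d {i, j} 1"
proof -
  have "all_exponents_from d ({i} \<union> {j}) (1 + 1)"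
    using assms by (intro all_exponents_from_Un all_exponents_from_singleton) auto
  moreover have "has_fixed_exponent (cyclic_2_product {i, j} d) 1"
  proof -
    define a :: "'a \<Rightarrow> 'a \<Rightarrow> int" where "a k l = (if k = l then 1 else if k = i then - 1 else - 2)" for k l
    define h where "h k = (if k = i then d j - 1 else d i)" for k
    have "has_fixed_exponent (cyclic_2_product {i, j} d) (\<Sum>k\<in>{i, j}. d k - h k)"
    proof (rule has_fixed_exponent_matrix_map[where a = a])
      show "2 ^ d k dvd a k l * 2 ^ d l" if "k \<in> {i, j}" "l \<in> {i, j}" for k l
        using that assms by (auto simp: a_def)
      show "h k \<le> d k" if "k \<in> {i, j}" for k
        using that assms by (auto simp: h_def)
      fix x :: "'a \<Rightarrow> int"
      have dvd: "(2::int) ^ d i dvd 2 ^ d j"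
        using assms by (auto intro: le_imp_power_dvd)
      show "\<forall>k\<in>{i, j}. 2 ^ d k dvd x k" if "\<forall>k\<in>{i, j}. 2 ^ d k dvd (\<Sum>l\<in>{i, j}. a k l * x l)"
      proof -
        have 1: "2 ^ d i dvd x i - x j" "2 ^ d j dvd x j - 2 * x i"
          using that assms(1) by (auto simp: a_def)
        then have "2 ^ d i dvd - ((x i - x j) + (x j - 2 * x i))"
          using dvd by (meson dvd_add dvd_minus_iff dvd_trans)
        then have i: "2 ^ d i dvd x i" by simp
        have "(2::int) ^ d j dvd 2 * 2 ^ d i"
          using assms(3) by auto
        also have "2 * 2 ^ d i dvd 2 * x i"
          using i by simp
        finally have "2 ^ d j dvd (x j - 2 * x i) + 2 * x i"
          using 1(2) by (rule dvd_add[rotated])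
        then show ?thesis using i by simp
      qed
      have "2 ^ d j dvd - (2 * x i) \<longleftrightarrow> 2 ^ (d j - 1) dvd x i"
        using assms(2,3) by (cases "d j") auto
      then show "(\<forall>k\<in>{i, j}. 2 ^ d k dvd (\<Sum>l\<in>{i, j}. a k l * x l) - x k) \<longleftrightarrow> (\<forall>k\<in>{i, j}. 2 ^ h k dvd x k)"
        using assms(1) by (auto simp: a_def h_def)
    qed simp
    moreover have "(\<Sum>k\<in>{i, j}. d k - h k) = 1"
      using assms by (auto simp: h_def)
    ultimately show ?thesis by simp
  qed
  ultimately show ?thesis
    using all_exponents_from_pred[of d "{i, j}" 1] by (simp add: insert_commute)
qed

text \<open>Only the exponent 0 is new, and \<open>(x, y) \<mapsto> (y, x + y)\<close> is an automorphism without nonzero fixed points.\<close>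

lemma all_exponents_from_constant_pair:
  assumes "i \<noteq> j" "1 \<le> d i" "d j = d i"
  shows "all_exponents_from d {i, j} 0"
proof (rule all_exponents_from_pred)
  show "all_exponents_from d {i, j} (Suc 0)"
    using all_exponents_from_pair[of i j d] assms by simp
  define a :: "'a \<Rightarrow> 'a \<Rightarrow> int" where "a k l = (if k = i \<and> l = i then 0 else 1)" for k l
  have "has_fixed_exponent (cyclic_2_product {i, j} d) (\<Sum>k\<in>{i, j}. d k - d k)"
  proof (rule has_fixed_exponent_matrix_map[where a = a])
    fix x :: "'a \<Rightarrow> int"
    show "\<forall>k\<in>{i, j}. 2 ^ d k dvd x k" if "\<forall>k\<in>{i, j}. 2 ^ d k dvd (\<Sum>l\<in>{i, j}. a k l * x l)"
      using that assms by (auto simp: a_def dvd_add_left_iff)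
    show "(\<forall>k\<in>{i, j}. 2 ^ d k dvd (\<Sum>l\<in>{i, j}. a k l * x l) - x k) \<longleftrightarrow> (\<forall>k\<in>{i, j}. 2 ^ d k dvd x k)"
      using assms dvd_add_left_iff[of "2 ^ d i" "x i" "x j - x i"] by (auto simp: a_def)
  qed (use assms in auto)
  then show "has_fixed_exponent (cyclic_2_product {i, j} d) 0" by simp
qed

text \<open>Splitting off a singleton at least doubles the number of fixed points, so blocks of odd length need an
automorphism of three equal summands without nonzero fixed points. The map \<open>(x, y, z) \<mapsto> (z, x + z, y)\<close> is
multiplication by \<open>T\<close> on polynomials modulo \<open>T^3 - T - 1\<close>; the values of this polynomial at 0 and at 1 are odd,
which makes the map and its difference from the identity invertible.\<close>

lemma all_exponents_from_constant_triple:
  assumes "i \<noteq> j" "i \<noteq> k" "j \<noteq> k" "1 \<le> d i" "d j = d i" "d k = d i"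
  shows "all_exponents_from d {i, j, k} 0"
proof (rule all_exponents_from_pred)
  have "all_exponents_from d ({i, j} \<union> {k}) (0 + 1)"
    using assms by (intro all_exponents_from_Un all_exponents_from_constant_pair all_exponents_from_singleton) auto
  moreover have "{i, j} \<union> {k} = {i, j, k}" by auto
  ultimately show "all_exponents_from d {i, j, k} (Suc 0)" by simp
  define a :: "'a \<Rightarrow> 'a \<Rightarrow> int" where
    "a p q = (if (p, q) \<in> {(i, k), (j, i), (j, k), (k, j)} then 1 else 0)" for p q
  have "has_fixed_exponent (cyclic_2_product {i, j, k} d) (\<Sum>l\<in>{i, j, k}. d l - d l)"
  proof (rule has_fixed_exponent_matrix_map[where a = a])
    fix x :: "'a \<Rightarrow> int"
    show "\<forall>l\<in>{i, j, k}. 2 ^ d l dvd x l" if "\<forall>l\<in>{i, j, k}. 2 ^ d l dvd (\<Sum>m\<in>{i, j, k}. a l m * x m)"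
      using that assms by (auto simp: a_def dvd_add_left_iff)
    show "(\<forall>l\<in>{i, j, k}. 2 ^ d l dvd (\<Sum>m\<in>{i, j, k}. a l m * x m) - x l) \<longleftrightarrow> (\<forall>l\<in>{i, j, k}. 2 ^ d l dvd x l)"
      (is "?L = ?R")
    proof
      assume ?L
      then have 1: "2 ^ d i dvd x k - x i" "2 ^ d i dvd x i + x k - x j" "2 ^ d i dvd x j - x k"
        using assms by (auto simp: a_def)
      have "2 ^ d i dvd x i"
        using dvd_add[OF 1(2,3)] by simp
      moreover from this have "2 ^ d i dvd x k"
        using dvd_add[OF 1(1)] by fastforce
      moreover from this have "2 ^ d i dvd x j"
        using dvd_add[OF 1(3)] by fastforce
      ultimately show ?R using assms by simp
    next
      assume ?R
      then show ?L using assms by (auto simp: a_def)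
    qed
  qed (use assms in auto)
  then show "has_fixed_exponent (cyclic_2_product {i, j, k} d) 0" by simp
qed

text \<open>Pairs are split off until a pair or a triple remains.\<close>

lemma all_exponents_from_constant_block:
  assumes "2 \<le> card A" "1 \<le> c" "\<And>i. i \<in> A \<Longrightarrow> d i = c"
  shows "all_exponents_from d A 0"
  using assms
proof (induction "card A" arbitrary: A rule: less_induct)
  case less
  then have fin: "finite A" using card.infinite by fastforce
  obtain i j where ij: "i \<in> A" "j \<in> A" "i \<noteq> j"
    using less.prems(1) by (metis card_le_Suc0_iff_eq fin not_less_eq_eq numeral_2_eq_2)
  have pair: "all_exponents_from d {i, j} 0"
    using ij less.prems by (intro all_exponents_from_constant_pair) auto
  have cardB: "card (A - {i, j}) = card A - 2"
    using ij fin by (simp add: card_Diff_subset)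
  consider "card (A - {i, j}) = 0" | "card (A - {i, j}) = 1" | "2 \<le> card (A - {i, j})"
    by linarith
  then show ?case
  proof cases
    case 1
    then have "A - {i, j} = {}" using fin by (metis card_0_eq finite_Diff)
    then have "A = {i, j}" using ij by auto
    then show ?thesis using pair by simp
  next
    case 2
    then obtain k where "A - {i, j} = {k}" by (auto simp: card_1_singleton_iff)
    then have "A = {i, j, k}" "k \<noteq> i" "k \<noteq> j" using ij by auto
    then show ?thesis
      using ij less.prems by (auto intro!: all_exponents_from_constant_triple)
  next
    case 3
    then have "all_exponents_from d (A - {i, j}) 0"
      using less.prems cardB by (intro less.hyps) auto
    then have "all_exponents_from d ({i, j} \<union> (A - {i, j})) (0 + 0)"
      using fin pair by (intro all_exponents_from_Un) auto
    moreover have "{i, j} \<union> (A - {i, j}) = A" using ij by auto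
    ultimately show ?thesis by simp
  qed
qed

section \<open>Combinatorics of the abc-decomposition\<close>

lemma constant_runs_subset: "A \<in> constant_runs e \<Longrightarrow> A \<subseteq> {..<length e}"
  by (auto simp: constant_runs_def)

lemma finite_constant_runs: "finite (constant_runs e)"
  by (rule finite_subset[of _ "Pow {..<length e}"]) (auto dest!: constant_runs_subset)

lemma constant_runs_nth_eq: "A \<in> constant_runs e \<Longrightarrow> i \<in> A \<Longrightarrow> j \<in> A \<Longrightarrow> e ! i = e ! j"
  unfolding constant_runs_def by (smt (verit) mem_Collect_eq)

lemma constant_runs_Un:
  assumes "A \<in> constant_runs e" "B \<in> constant_runs e" "A \<inter> B \<noteq> {}"
  shows "A \<union> B \<in> constant_runs e"
proof -
  obtain x where x: "x \<in> A" "x \<in> B" using assms(3) by auto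
  obtain i j i' j' where A: "A = {i..j}" "i \<le> j" "j < length e"
    and B: "B = {i'..j'}" "i' \<le> j'" "j' < length e"
    using assms(1,2) unfolding constant_runs_def by blast
  have Un: "A \<union> B = {min i i'..max j j'}"
    using A B x by auto
  have const: "e ! k = e ! x" if "k \<in> A \<union> B" for k
    using that x constant_runs_nth_eq[OF assms(1)] constant_runs_nth_eq[OF assms(2)] by blast
  have "min i i' \<in> A \<union> B"
    using A(2) B(2) by (simp add: Un)
  then have "\<forall>k\<in>{min i i'..max j j'}. e ! k = e ! min i i'"
    using const Un by metis
  moreover have "min i i' \<le> max j j'" "max j j' < length e"
    using A B by auto
  ultimately show ?thesis
    unfolding constant_runs_def Un by blast
qed

lemma disjoint_a_blocks: "pairwise disjnt (a_blocks e)"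
proof (rule pairwiseI)
  fix A B assume AB: "A \<in> a_blocks e" "B \<in> a_blocks e" "A \<noteq> B"
  show "disjnt A B"
  proof (rule ccontr)
    assume "\<not> disjnt A B"
    then have "A \<union> B \<in> constant_runs e"
      using AB by (intro constant_runs_Un) (auto simp: a_blocks_def disjnt_def)
    then have "A = A \<union> B" "B = A \<union> B"
      using AB by (auto simp: a_blocks_def)
    then show False using AB(3) by simp
  qed
qed

lemma equal_neighbours_in_a_block:
  assumes "Suc k < length e" "e ! Suc k = e ! k"
  shows "k \<in> \<Union> (a_blocks e)" "Suc k \<in> \<Union> (a_blocks e)"
proof -
  have "{k..Suc k} \<in> constant_runs e"
    unfolding constant_runs_def using assms
    by (intro CollectI exI[of _ k] exI[of _ "Suc k"]) (auto simp: le_Suc_eq)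
  then obtain A where A: "A \<in> constant_runs e" "{k..Suc k} \<subseteq> A"
    and max: "\<forall>B\<in>constant_runs e. A \<subseteq> B \<longrightarrow> A = B"
    using finite_has_maximal2[OF finite_constant_runs] by metis
  have "finite A"
    using A(1) constant_runs_subset finite_subset by blast
  then have "card {k..Suc k} \<le> card A"
    using A(2) by (intro card_mono)
  then have "A \<in> a_blocks e"
    using A(1) max by (auto simp: a_blocks_def)
  moreover have "k \<in> A" "Suc k \<in> A"
    using A(2) by (auto simp: subset_iff)
  ultimately show "k \<in> \<Union> (a_blocks e)" "Suc k \<in> \<Union> (a_blocks e)"
    by blast+
qed

lemma b_search_pair:
  assumes "B \<in> b_search e U i"
  shows "\<exists>k\<ge>i. B = {k, Suc k} \<and> k \<in> U \<and> Suc k \<in> U \<and> Suc k < length e \<and> e ! Suc k = e ! k + 1"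
  using assms
proof (induction e U i rule: b_search.induct)
  case (1 e U i)
  let ?pair = "i \<in> U \<and> Suc i \<in> U \<and> e ! Suc i = e ! i + 1"
  have len: "Suc i < length e"
    using "1.prems" by (subst (asm) b_search.simps) (simp split: if_splits)
  consider "?pair" "B = {i, Suc i}" | "?pair" "B \<in> b_search e U (i + 2)"
    | "\<not> ?pair" "B \<in> b_search e U (i + 1)"
    using "1.prems" len by (subst (asm) b_search.simps) (simp split: if_splits, blast)
  then show ?case
  proof cases
    case 1
    then show ?thesis using len by blast
  next
    case 2
    then show ?thesis using "1.IH"(1)[OF len] by (meson add_leD1)
  next
    case 3
    then show ?thesis using "1.IH"(2)[OF len] by (meson add_leD1)
  qed
qed

lemma disjoint_b_search: "pairwise disjnt (b_search e U i)"
proof (induction e U i rule: b_search.induct)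
  case (1 e U i)
  have "disjnt {i, Suc i} B" if "B \<in> b_search e U (i + 2)" for B
    using b_search_pair[OF that] by (auto simp: disjnt_def)
  then show ?case
    using 1 by (subst b_search.simps) (auto simp: pairwise_insert disjnt_sym)
qed

text \<open>Greediness: a pair that could be formed is skipped only if its first entry has already been used as the
second entry of the preceding pair.\<close>

lemma b_search_covers:
  assumes "i \<le> k" "Suc k < length e" "k \<in> U" "Suc k \<in> U" "e ! Suc k = e ! k + 1"
  shows "k \<in> \<Union> (b_search e U i)"
  using assms
proof (induction e U i rule: b_search.induct)
  case (1 e U i)
  show ?case
  proof (cases "i \<in> U \<and> Suc i \<in> U \<and> e ! Suc i = e ! i + 1")
    case True
    then have eq: "b_search e U i = insert {i, Suc i} (b_search e U (i + 2))"
      using "1.prems" by (subst b_search.simps) auto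
    show ?thesis
    proof (cases "i + 2 \<le> k")
      case True': True
      then show ?thesis
        using 1 True by (simp add: eq)
    next
      case False
      then show ?thesis
        using "1.prems"(1) by (auto simp: eq)
    qed
  next
    case False
    then have eq: "b_search e U i = b_search e U (i + 1)"
      using "1.prems" by (subst b_search.simps) auto
    have "i + 1 \<le> k"
      using "1.prems" False by (cases "i = k") auto
    then show ?thesis
      using 1 False by (simp add: eq)
  qed
qed

definition abc_blocks :: "nat list \<Rightarrow> nat set set"
  where "abc_blocks e = a_blocks e \<union> (b_blocks e \<union> c_blocks e)"

lemma b_block_pair:
  assumes "B \<in> b_blocks e"
  obtains k where "B = {k, Suc k}" "Suc k < length e" "e ! Suc k = Suc (e ! k)"
    "k \<notin> \<Union> (a_blocks e)" "Suc k \<notin> \<Union> (a_blocks e)"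
  using b_search_pair[OF assms[unfolded b_blocks_def]] by auto

lemma abc_blocks_subset: "B \<in> abc_blocks e \<Longrightarrow> B \<subseteq> {..<length e}"
  using constant_runs_subset
  by (auto simp: abc_blocks_def a_blocks_def c_blocks_def elim!: b_block_pair)

lemma finite_abc_blocks: "finite (abc_blocks e)"
  by (rule finite_subset[of _ "Pow {..<length e}"]) (auto dest!: abc_blocks_subset)

lemma finite_abc_block: "B \<in> abc_blocks e \<Longrightarrow> finite B"
  using abc_blocks_subset finite_subset by blast

lemma abc_block_nonempty: "B \<in> abc_blocks e \<Longrightarrow> B \<noteq> {}"
  by (auto simp: abc_blocks_def a_blocks_def c_blocks_def elim: b_block_pair)

lemma disjoint_abc_blocks: "pairwise disjnt (abc_blocks e)"
proof -
  have "disjnt A B" if "A \<in> a_blocks e" "B \<in> b_blocks e" for A B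
    using that(1) by (rule_tac b_block_pair[OF that(2)]) (auto simp: disjnt_def)
  moreover have "disjnt A B" if "A \<in> a_blocks e \<union> b_blocks e" "B \<in> c_blocks e" for A B
    using that by (auto simp: disjnt_def c_blocks_def)
  moreover have "pairwise disjnt (b_blocks e)"
    unfolding b_blocks_def by (rule disjoint_b_search)
  moreover have "pairwise disjnt (c_blocks e)"
    by (auto simp: c_blocks_def pairwise_def)
  ultimately show ?thesis
    using disjoint_a_blocks[of e] unfolding abc_blocks_def pairwise_def
    by (metis Un_iff disjnt_sym)
qed

lemma Union_abc_blocks: "\<Union> (abc_blocks e) = {..<length e}"
proof
  show "{..<length e} \<subseteq> \<Union> (abc_blocks e)"
  proof
    fix i assume i: "i \<in> {..<length e}"
    show "i \<in> \<Union> (abc_blocks e)"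
    proof (cases "i \<in> \<Union> (a_blocks e \<union> b_blocks e)")
      case False
      then have "{i} \<in> c_blocks e"
        using i by (auto simp: c_blocks_def)
      then show ?thesis by (auto simp: abc_blocks_def)
    qed (auto simp: abc_blocks_def)
  qed
qed (use abc_blocks_subset in blast)

lemma same_abc_block:
  assumes "A \<in> abc_blocks e" "B \<in> abc_blocks e" "x \<in> A" "x \<in> B"
  shows "A = B"
  using assms disjoint_abc_blocks[of e] by (auto simp: pairwise_def disjnt_iff)

lemma card_bc_blocks: "card (b_blocks e \<union> c_blocks e) = b_num e + c_num e"
proof -
  have "b_blocks e \<inter> c_blocks e = {}"
    using abc_block_nonempty[of _ e] by (fastforce simp: abc_blocks_def c_blocks_def)
  moreover have "finite (b_blocks e)" "finite (c_blocks e)"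
    using finite_abc_blocks[of e] by (auto simp: abc_blocks_def)
  ultimately show ?thesis
    unfolding b_num_def c_num_def by (intro card_Un_disjoint)
qed

lemma all_exponents_from_abc_blocks:
  assumes pos: "\<forall>x\<in>set e. 1 \<le> x"
  shows "all_exponents_from (nth e) {..<length e} (b_num e + c_num e)"
proof -
  define l :: "nat set \<Rightarrow> nat" where "l B = (if B \<in> a_blocks e then 0 else 1)" for B
  have ge1: "1 \<le> e ! i" if "i < length e" for i
    using pos that by simp
  have "all_exponents_from (nth e) B (l B)" if B: "B \<in> abc_blocks e" for B
  proof (cases "B \<in> a_blocks e")
    case True
    then have "B \<in> constant_runs e" "2 \<le> card B"
      by (auto simp: a_blocks_def)
    moreover obtain i where i: "i \<in> B"
      using abc_block_nonempty[OF B] by auto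
    ultimately show ?thesis
      using True ge1[of i] abc_blocks_subset[OF B]
      by (auto simp: l_def intro!: all_exponents_from_constant_block[where c = "e ! i"]
          intro: constant_runs_nth_eq)
  next
    case False
    then consider "B \<in> b_blocks e" | "B \<in> c_blocks e"
      using B by (auto simp: abc_blocks_def)
    then show ?thesis
    proof cases
      case 1
      then obtain k where "B = {k, Suc k}" "Suc k < length e" "e ! Suc k = Suc (e ! k)"
        by (rule b_block_pair)
      then show ?thesis
        using False ge1[of k] by (auto simp: l_def intro!: all_exponents_from_pair[simplified])
    next
      case 2
      then obtain i where "B = {i}" "i < length e" by (auto simp: c_blocks_def)
      then show ?thesis
        using False ge1[of i] by (auto simp: l_def intro!: all_exponents_from_singleton[simplified])
    qed
  qed
  then have "all_exponents_from (nth e) (\<Union> (abc_blocks e)) (\<Sum>B\<in>abc_blocks e. l B)"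
    by (intro all_exponents_from_Union finite_abc_blocks finite_abc_block disjoint_abc_blocks)
  moreover have "(\<Sum>B\<in>abc_blocks e. l B) = card (b_blocks e \<union> c_blocks e)"
  proof -
    have disj: "a_blocks e \<inter> (b_blocks e \<union> c_blocks e) = {}"
      using abc_block_nonempty[of _ e]
      by (fastforce simp: abc_blocks_def c_blocks_def elim: b_block_pair)
    have fin: "finite (a_blocks e)" "finite (b_blocks e \<union> c_blocks e)"
      using finite_abc_blocks[of e] by (auto simp: abc_blocks_def)
    have "(\<Sum>B\<in>abc_blocks e. l B) = (\<Sum>B\<in>a_blocks e. l B) + (\<Sum>B\<in>b_blocks e \<union> c_blocks e. l B)"
      unfolding abc_blocks_def by (rule sum.union_disjoint[OF fin disj])
    also have "(\<Sum>B\<in>a_blocks e. l B) = 0"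
      by (simp add: l_def)
    also have "(\<Sum>B\<in>b_blocks e \<union> c_blocks e. l B) = (\<Sum>B\<in>b_blocks e \<union> c_blocks e. 1)"
      by (rule sum.cong) (use disj in \<open>auto simp: l_def\<close>)
    finally show ?thesis by simp
  qed
  ultimately show ?thesis
    by (simp add: Union_abc_blocks card_bc_blocks)
qed

text \<open>The first positions of the b- and c-blocks carry simple exponents, because in a sorted list equal
exponents have equal neighbours and so lie in a-blocks. If two of these exponents were consecutive integers, they would be
neighbours \<open>s\<close> and \<open>Suc s\<close>; by greediness \<open>s\<close> would lie in a b-block, which would be \<open>{s, Suc s}\<close>, and then
\<open>Suc s\<close> would not be first in its block.\<close>

lemma card_fixed_points_ge_abc:
  assumes e: "sorted e" "\<forall>x\<in>set e. 1 \<le> x"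
    and \<phi>: "\<phi> \<in> iso (cyclic_2_product {..<length e} (nth e)) (cyclic_2_product {..<length e} (nth e))"
  shows "2 ^ (b_num e + c_num e) \<le> card (fixed_points (cyclic_2_product {..<length e} (nth e)) \<phi>)"
proof -
  define M where "M = b_blocks e \<union> c_blocks e"
  define S where "S = Min ` M"
  have M: "B \<in> abc_blocks e" "B \<notin> a_blocks e" if "B \<in> M" for B
    using that abc_block_nonempty[of B e]
    by (auto simp: M_def abc_blocks_def c_blocks_def elim!: b_block_pair)
  have Min_in: "Min B \<in> B" if "B \<in> M" for B
    using M[OF that] finite_abc_block abc_block_nonempty by (intro Min_in) auto
  have "inj_on Min M"
    using Min_in M same_abc_block by (metis inj_onI)
  then have "card S = b_num e + c_num e"
    by (simp add: S_def card_image M_def card_bc_blocks)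
  have sub: "S \<subseteq> {..<length e}"
    using Min_in M abc_blocks_subset by (fastforce simp: S_def)
  have notin_a: "s \<notin> \<Union> (a_blocks e)" if s: "s \<in> S" for s
  proof
    assume "s \<in> \<Union> (a_blocks e)"
    then obtain A where A: "A \<in> a_blocks e" "s \<in> A" by auto
    obtain B where B: "B \<in> M" "s = Min B" using s by (auto simp: S_def)
    have "A = B"
      using A B Min_in[OF B(1)] M[OF B(1)] by (intro same_abc_block[of A e B s]) (auto simp: abc_blocks_def)
    then show False using A M[OF B(1)] by simp
  qed
  have simple: "i = s" if s: "s \<in> S" and i: "i < length e" and eq: "e ! i = e ! s" for s i
  proof (rule ccontr)
    assume "i \<noteq> s"
    have sl: "s < length e" using s sub by auto
    consider "i < s" | "s < i" using \<open>i \<noteq> s\<close> by linarith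
    then show False
    proof cases
      case 1
      then obtain k where k: "s = Suc k" "i \<le> k" by (metis less_Suc_eq_le not0_implies_Suc not_less0)
      then have "e ! i \<le> e ! k" "e ! k \<le> e ! s"
        using sl e(1) by (auto intro: sorted_nth_mono)
      then show False
        using equal_neighbours_in_a_block(2)[of k e] notin_a[OF s] eq sl k by simp
    next
      case 2
      then have "e ! s \<le> e ! Suc s" "e ! Suc s \<le> e ! i"
        using i e(1) by (auto intro: sorted_nth_mono)
      then show False
        using equal_neighbours_in_a_block(1)[of s e] notin_a[OF s] eq i 2 by simp
    qed
  qed
  have separated: "e ! t \<noteq> Suc (e ! s)" if s: "s \<in> S" and t: "t \<in> S" for s t
  proof
    assume eq: "e ! t = Suc (e ! s)"
    have sl: "s < length e" "t < length e" using s t sub by auto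
    have "s < t"
      using sorted_nth_mono[OF e(1), of t s] sl eq by (metis Suc_n_not_le_n not_less)
    have ts: "t = Suc s"
    proof (rule ccontr)
      assume "t \<noteq> Suc s"
      then have "Suc s < t" using \<open>s < t\<close> by simp
      then have "e ! s \<le> e ! Suc s" "e ! Suc s \<le> e ! t"
        using sl e(1) by (auto intro: sorted_nth_mono)
      then have "e ! Suc s = e ! s \<or> e ! Suc s = e ! t" using eq by linarith
      then show False
        using simple[OF s, of "Suc s"] simple[OF t, of "Suc s"] \<open>Suc s < t\<close> sl by auto
    qed
    have "s \<in> \<Union> (b_blocks e)"
      unfolding b_blocks_def using ts sl eq notin_a[OF s] notin_a[OF t]
      by (intro b_search_covers) auto
    then obtain B where B: "B \<in> b_blocks e" "s \<in> B" by auto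
    obtain B1 where B1: "B1 \<in> M" "s = Min B1" using s by (auto simp: S_def)
    obtain B2 where B2: "B2 \<in> M" "t = Min B2" using t by (auto simp: S_def)
    have BM: "B \<in> M" using B by (simp add: M_def)
    have eq1: "B = B1"
      using B B1 BM Min_in M same_abc_block by metis
    obtain k where k: "B = {k, Suc k}"
      using B(1) by (rule b_block_pair)
    have "s = Min {k, Suc k}" using B1 eq1 k by metis
    then have "s = k" by simp
    then have "t \<in> B" using ts k by simp
    then have "B = B2"
      using B2 BM Min_in M same_abc_block by metis
    then show False using eq1 B1 B2 \<open>s < t\<close> by simp
  qed
  have "2 ^ card S \<le> card (fixed_points (cyclic_2_product {..<length e} (nth e)) \<phi>)"
  proof (rule card_fixed_points_lower_bound[OF _ sub _ _ _ \<phi>])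
    show "1 \<le> e ! s" if "s \<in> S" for s
      using that sub e(2) by auto
  qed (use simple separated in auto)
  then show ?thesis
    using \<open>card S = b_num e + c_num e\<close> by simp
qed

section \<open>The Reidemeister spectrum\<close>

lemma sum_group_eq_product_group:
  assumes "finite I" "\<And>i. i \<in> I \<Longrightarrow> group (G i)"
  shows "sum_group I G = product_group I G"
  using assms group.subgroup_generated_group_carrier[OF product_group[of I G]]
  by (simp add: sum_group_def)

theorem corollary4p16:
  fixes P :: "('a, 'b) monoid_scheme" and e :: "nat list" and n :: nat
  assumes "comm_group P" and "finite (carrier P)" and "\<exists>k. order P = 2 ^ k"
    and "n \<ge> 1" and "e \<in> group_types n" and "of_type P e"
  shows "reidemeister_spectrum P = {2 ^ i | i. i \<in> {b_num e + c_num e..sum_list e}}"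
proof -
  let ?C = "cyclic_2_product {..<length e} (nth e)"
  interpret P: comm_group P by fact
  interpret C: comm_group ?C by (rule comm_group_cyclic_2_product)
  have e: "sorted e" "\<forall>x\<in>set e. 1 \<le> x"
    using assms(5) by (auto simp: group_types_def)
  have iso: "P \<cong> ?C"
    using assms(6) by (simp add: of_type_def cyclic_2_product_def sum_group_eq_product_group)
  have sum: "(\<Sum>i<length e. e ! i) = sum_list e"
    by (simp add: sum_list_sum_nth atLeast0LessThan)
  have order: "order P = 2 ^ sum_list e"
    using iso_same_card[OF iso] card_cyclic_2_product[of "{..<length e}" "nth e"]
    by (simp add: order_def sum)
  have "(\<exists>\<phi>\<in>iso P P. card (fixed_points P \<phi>) = m) \<longleftrightarrow>
      (\<exists>i\<in>{b_num e + c_num e..sum_list e}. m = 2 ^ i)" (is "?L \<longleftrightarrow> ?R") for m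
  proof
    assume ?L
    then obtain \<phi> where \<phi>: "\<phi> \<in> iso P P" and m: "card (fixed_points P \<phi>) = m" by auto
    interpret \<phi>: group_hom P P \<phi>
      using \<phi> by unfold_locales (simp add: iso_def)
    have "subgroup (fixed_points P \<phi>) P"
    proof (rule P.subgroupI)
      show "fixed_points P \<phi> \<noteq> {}"
        using \<phi>.hom_one by (auto simp: fixed_points_def)
    qed (auto simp: fixed_points_def)
    then have "m dvd 2 ^ sum_list e"
      using P.lagrange order m by (metis dvd_triv_right)
    then obtain i where i: "i \<le> sum_list e" "m = 2 ^ i"
      using divides_primepow_nat[OF two_is_prime_nat] by auto
    obtain h where "h \<in> iso P ?C" using iso by (auto simp: is_iso_def)
    then obtain \<psi> where "\<psi> \<in> iso ?C ?C" "card (fixed_points ?C \<psi>) = m"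
      using conjugate_automorphism[OF P.is_group C.is_group _ \<phi>] m by metis
    then have "2 ^ (b_num e + c_num e) \<le> (2::nat) ^ i"
      using card_fixed_points_ge_abc[OF e] i(2) by metis
    then show ?R using i by auto
  next
    assume ?R
    then obtain i where i: "b_num e + c_num e \<le> i" "i \<le> sum_list e" "m = 2 ^ i" by auto
    then have "has_fixed_exponent ?C i"
      using all_exponents_from_abc_blocks[OF e(2)] by (simp add: all_exponents_from_def sum)
    then have "has_fixed_exponent P i"
      by (rule has_fixed_exponent_iso[OF C.is_group P.is_group P.iso_sym[OF iso]])
    then show ?L using i by (auto simp: has_fixed_exponent_def)
  qed
  then have "(\<lambda>\<phi>. card (fixed_points P \<phi>)) ` iso P P = (\<lambda>i. 2 ^ i) ` {b_num e + c_num e..sum_list e}"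
    unfolding set_eq_iff image_iff by metis
  then have "(\<lambda>\<phi>. enat (card (fixed_points P \<phi>))) ` iso P P = (\<lambda>i. enat (2 ^ i)) ` {b_num e + c_num e..sum_list e}"
    by (metis image_image)
  moreover have "enat (2 ^ i) = 2 ^ i" for i
  proof (induction i)
    case (Suc i)
    have "enat (2 ^ Suc i) = enat 2 * enat (2 ^ i)" by simp
    then show ?case using Suc by (simp only: power_Suc numeral_eq_enat)
  qed (simp add: one_enat_def)
  ultimately show ?thesis
    unfolding P.reidemeister_spectrum_eq_card_fixed_points[OF assms(2)]
    by auto
qed

end
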